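(* Let $A$ be a unital semi-simple commutative Banach algebra and $B$ a unital commutative Banach algebra. Let $p(z,w)=zw+az+bw+c$, where $a,b,c\in\mathbb{C}$. Suppose that $T$ is a map (not assumed to be linear, multiplicative or continuous) from $A$ onto $B$ such that the equality \[ \sigma(p(Tf,Tg))=\sigma(p(f,g)) \] holds for every pair $f$ and $g$ in $A$. Then the following hold. (1) If $a\neq b$, then $T$ is an algebra isomorphism from $A$ onto $B$. Thus there exists a homeomorphism $\Phi$ from $M_B$ onto $M_A$ such that the equality \[ \widehat{Tf}(y)=\hat f(\Phi(y)),\quad y\in M_B, \] holds for every $f\in A$. (2) If $a=b$, then there exist a map $\eta:M_B\to\{-1,1\}$ and a homeomorphism $\Phi$ from $M_B$ onto $M_A$ such that the equality \[ \widehat{Tf}(y)=\eta(y)\hat f(\Phi(y))+a(\eta(y)-1),\quad y\in M_B, \] holds for every $f\in A$. In any case, $B$ is semi-simple and $A$ is algebraically isomorphic to $B$.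
   Context: Banach algebras are over the complex field $\mathbb{C}$. $\sigma(\cdot)$ denotes the spectrum of an element in the algebra to which it belongs. For $f,g\in A$, $p(f,g)$ denotes $fg+af+bg+c\cdot 1\in A$, and similarly in $B$. For a commutative Banach algebra $\mathcal{A}$, $M_{\mathcal{A}}$ denotes its maximal ideal space (with the Gelfand topology) and $\hat f$ denotes the Gelfand transform of $f\in\mathcal{A}$. "Algebraically isomorphic" means that there is an algebra isomorphism (not assumed isometric) from $A$ onto $B$. *)

theory Defs
  imports "HOL-Analysis.Analysis"
begin

text \<open>
  Unital commutative complex Banach algebras. The library provides only real normed algebras; the
  real scalar multiplication inherited from there is the restriction of the complex one.
  The unit is nonzero, but its norm is not required to be \<open>1\<close>.
\<close>

class complex_comm_banach_algebra_1 = real_normed_algebra + comm_ring_1 + banach +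
  fixes scaleC :: "complex \<Rightarrow> 'a \<Rightarrow> 'a"  (infixr \<open>*\<^sub>C\<close> 75)
  assumes scaleC_add_right: "\<alpha> *\<^sub>C (x + y) = \<alpha> *\<^sub>C x + \<alpha> *\<^sub>C y"
    and scaleC_add_left: "(\<alpha> + \<beta>) *\<^sub>C x = \<alpha> *\<^sub>C x + \<beta> *\<^sub>C x"
    and scaleC_scaleC: "\<alpha> *\<^sub>C (\<beta> *\<^sub>C x) = (\<alpha> * \<beta>) *\<^sub>C x"
    and scaleC_one: "1 *\<^sub>C x = x"
    and mult_scaleC_left: "(\<alpha> *\<^sub>C x) * y = \<alpha> *\<^sub>C (x * y)"
    and norm_scaleC: "norm (\<alpha> *\<^sub>C x) = cmod \<alpha> * norm x"
    and scaleR_scaleC: "scaleR r x = complex_of_real r *\<^sub>C x"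

definition spectrum :: "'a::complex_comm_banach_algebra_1 \<Rightarrow> complex set" where
  "spectrum x = {z. \<not> (\<exists>y. (z *\<^sub>C 1 - x) * y = 1)}"

definition is_ideal :: "'a::comm_ring_1 set \<Rightarrow> bool" where
  "is_ideal I \<longleftrightarrow>
     0 \<in> I \<and> (\<forall>x\<in>I. \<forall>y\<in>I. x + y \<in> I) \<and> (\<forall>r. \<forall>x\<in>I. r * x \<in> I)"

definition is_maximal_ideal :: "'a::comm_ring_1 set \<Rightarrow> bool" where
  "is_maximal_ideal I \<longleftrightarrow>
     is_ideal I \<and> I \<noteq> UNIV \<and> (\<forall>J. is_ideal J \<and> I \<subseteq> J \<longrightarrow> J = I \<or> J = UNIV)"

definition jacobson_radical :: "'a::comm_ring_1 set" where
  "jacobson_radical = \<Inter> {I. is_maximal_ideal I}"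

definition semisimple :: "'a::comm_ring_1 itself \<Rightarrow> bool" where
  "semisimple _ \<longleftrightarrow> (jacobson_radical :: 'a set) = {0}"

definition algebra_isomorphism ::
    "('a::complex_comm_banach_algebra_1 \<Rightarrow> 'b::complex_comm_banach_algebra_1) \<Rightarrow> bool" where
  "algebra_isomorphism S \<longleftrightarrow>
     bij S \<and> (\<forall>f g. S (f + g) = S f + S g) \<and> (\<forall>\<alpha> f. S (\<alpha> *\<^sub>C f) = \<alpha> *\<^sub>C S f) \<and>
     (\<forall>f g. S (f * g) = S f * S g)"

text \<open>
  As usual, maximal ideals are identified with the nonzero multiplicative linear functionals (whose
  kernels they are); these are automatically continuous.
\<close>

definition maximal_ideal_space :: "('a::complex_comm_banach_algebra_1 \<Rightarrow> complex) set" where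
  "maximal_ideal_space =
     {\<phi>. (\<forall>f g. \<phi> (f + g) = \<phi> f + \<phi> g) \<and> (\<forall>\<alpha> f. \<phi> (\<alpha> *\<^sub>C f) = \<alpha> * \<phi> f) \<and>
         (\<forall>f g. \<phi> (f * g) = \<phi> f * \<phi> g) \<and> (\<exists>f. \<phi> f \<noteq> 0)}"

definition gelfand_transform ::
    "'a::complex_comm_banach_algebra_1 \<Rightarrow> ('a \<Rightarrow> complex) \<Rightarrow> complex" where
  "gelfand_transform f \<phi> = \<phi> f"

text \<open>
  The topology of pointwise convergence on the algebra, that is, the coarsest topology on the
  maximal ideal space for which all Gelfand transforms are continuous.
\<close>

definition gelfand_topology :: "('a::complex_comm_banach_algebra_1 \<Rightarrow> complex) topology" where
  "gelfand_topology = subtopology (product_topology (\<lambda>_. euclidean) UNIV) maximal_ideal_space"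

definition quad_poly ::
    "complex \<Rightarrow> complex \<Rightarrow> complex \<Rightarrow> 'a::complex_comm_banach_algebra_1 \<Rightarrow> 'a \<Rightarrow> 'a" where
  "quad_poly a b c f g = f * g + a *\<^sub>C f + b *\<^sub>C g + c *\<^sub>C 1"

end

theory Submission
  imports Defs "HOL-Computational_Algebra.Fundamental_Theorem_Algebra"
begin

text \<open>
  Since \<open>p(z, w) = (z + b) (w + a) + (c - a b)\<close>, the shifted maps \<open>S1 F = T (F - b) + b\<close> and
  \<open>S2 G = T (G - a) + a\<close> satisfy \<open>\<sigma>(S1 F S2 G) = \<sigma>(F G)\<close>. The normalization \<open>U = S1 / S1 1\<close> is a
  bijection between the groups of units that preserves the spectra of quotients. Vaisala's
  reflection argument for the Mazur--Ulam theorem, carried out in these groups, shows that \<open>U\<close> is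
  locally multiplicative. Hence \<open>\<phi> (U e\<^sup>f) = e\<^bsup>L f\<^esup>\<close> for each character \<open>\<phi>\<close> of \<open>B\<close>, with \<open>L\<close> additive
  and \<open>L f \<in> \<sigma>(f)\<close>, and such an \<open>L\<close> is a character \<open>\<Phi> \<phi>\<close> of \<open>A\<close> (Gleason--Kahane--Zelazko,
  Kowalski--Slodkowski). For arbitrary \<open>F\<close> the functions \<open>\<phi> \<mapsto> \<phi> (U F)\<close> and \<open>\<phi> \<mapsto> \<Phi> \<phi> F\<close>, multiplied
  by any \<open>e\<^bsup>\<Phi> \<phi> f\<^esup>\<close>, have the same range; concentrating the exponential factor near a point where
  the pair of functions is exposed shows that they coincide. So \<open>U\<close> is an isomorphism, and comparing
  \<open>S1\<close> with \<open>S2\<close> determines \<open>S1 1\<close>.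
\<close>

section \<open>Neumann series and the Gelfand--Mazur theorem\<close>

text \<open>The hypothesis says something about \<open>U\<close> only through products with units,
  so values at non-invertible elements come last. Ratio sets over the characters take the place of a
  metric. The Mazur-Ulam argument needs an initial bound on how far a midpoint can move, and this
  exists only for close units; hence multiplicativity is first local, and logarithms live on a small
  ball.

  The final comparison meets an obstacle. The exponential factor must peak at a point of the set of
  pairs (\<open>\<Phi> \<phi> F\<close>, \<open>\<phi> (U F)\<close>), so its exponent has to
  involve both coordinates, while only exponents \<open>\<Phi> \<phi> f\<close> with
  \<open>f\<close> in A are available. The second coordinate is therefore pulled back to A: if
  \<open>W\<close> inverts \<open>U\<close> on units, then n (W (exp (U F / n)) - 1) has the value n
  (exp (\<phi> (U F) / n) - 1) at \<open>\<Phi> \<phi>\<close>, which tends to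
  \<open>\<phi> (U F)\<close> uniformly in \<phi>. This rests on \<open>W\<close> inducing the
  inverse of \<Phi> on characters, which is obtained from the same difference quotient. Passing to
  the closure of the set of pairs supplies compactness without any topology on the
  characters.\<close>

definition cc :: "complex \<Rightarrow> 'a::complex_comm_banach_algebra_1" where
  "cc z = z *\<^sub>C 1"

lemma scaleC_eq_cc: "z *\<^sub>C x = cc z * x"
  by (simp add: cc_def mult_scaleC_left)

lemma cc_add: "cc (z + w) = cc z + cc w"
  by (simp add: cc_def scaleC_add_left)

lemma cc_mult: "cc (z * w) = cc z * cc w"
  by (simp add: cc_def scaleC_scaleC mult_scaleC_left)

lemma cc_1 [simp]: "cc 1 = 1"
  by (simp add: cc_def scaleC_one)

lemma cc_0 [simp]: "cc 0 = 0"
  using cc_add[of 0 0] by simp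

lemma cc_minus: "cc (- z) = - cc z"
  using cc_add[of z "- z"] by (simp add: eq_neg_iff_add_eq_0 add.commute)

lemma cc_diff: "cc (z - w) = cc z - cc w"
  using cc_add[of z "- w"] by (simp add: cc_minus)

lemma cc_power: "cc (z ^ n) = cc z ^ n"
  by (induction n) (simp_all add: cc_mult)

lemma cc_of_nat: "cc (of_nat n) = of_nat n"
  by (induction n) (simp_all add: cc_add)

lemma cc_sum: "cc (\<Sum>i\<in>S. f i) = (\<Sum>i\<in>S. cc (f i))"
  by (induction S rule: infinite_finite_induct) (simp_all add: cc_add)

lemma norm_cc_mult: "norm (cc z * x) = cmod z * norm x"
  by (metis scaleC_eq_cc norm_scaleC)

lemma scaleR_eq_cc: "r *\<^sub>R x = cc (complex_of_real r) * x"
  by (simp add: scaleR_scaleC scaleC_eq_cc)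

lemma norm_power_le:
  "norm (x ^ n) \<le> norm (1 :: 'a) * norm x ^ n" for x :: "'a::complex_comm_banach_algebra_1"
proof (induction n)
  case (Suc n)
  have "norm (x ^ Suc n) \<le> norm x * norm (x ^ n)"
    by (simp add: norm_mult_ineq)
  also have "\<dots> \<le> norm x * (norm (1::'a) * norm x ^ n)"
    using Suc by (intro mult_left_mono) auto
  finally show ?case by (simp add: mult_ac)
qed simp

lemma neumann_inverse:
  fixes x :: "'a::complex_comm_banach_algebra_1"
  assumes "norm x < 1"
  shows "\<exists>y. (1 - x) * y = 1"
proof -
  have s: "summable (\<lambda>n. x ^ n)"
  proof (rule summable_comparison_test)
    show "\<exists>N. \<forall>n\<ge>N. norm (x ^ n) \<le> norm (1::'a) * norm x ^ n"
      using norm_power_le by blast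
    show "summable (\<lambda>n. norm (1::'a) * norm x ^ n)"
      using assms by (intro summable_mult summable_geometric) auto
  qed
  have "(\<Sum>n. x ^ n) = 1 + (\<Sum>n. x ^ Suc n)"
    using suminf_split_head[OF s] by simp
  also have "(\<Sum>n. x ^ Suc n) = x * (\<Sum>n. x ^ n)"
    using suminf_mult[OF s, of x] by simp
  finally show ?thesis
    by (intro exI[of _ "\<Sum>n. x ^ n"]) (simp add: algebra_simps)
qed

lemma spectrum_bound:
  assumes "z \<in> spectrum x"
  shows "cmod z \<le> norm x"
proof (rule ccontr)
  assume "\<not> ?thesis"
  then have z: "norm x < cmod z" "z \<noteq> 0"
    using norm_ge_zero[of x] by auto
  then have "norm (cc (inverse z) * x) < 1"
    by (simp add: norm_cc_mult norm_inverse norm_divide divide_simps)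
  then obtain y where "(1 - cc (inverse z) * x) * y = 1"
    using neumann_inverse by blast
  moreover have "cc z * cc (inverse z) = (1::'a)"
    using z by (simp flip: cc_mult)
  moreover have "(cc z - x) * (cc (inverse z) * y) = (cc z * cc (inverse z) - cc (inverse z) * x) * y"
    by (simp add: algebra_simps)
  ultimately have "(cc z - x) * (cc (inverse z) * y) = 1"
    by metis
  then show False
    using assms by (auto simp: spectrum_def cc_def)
qed

text \<open>Models the quotient of the algebra by the ideal where \<open>q\<close> vanishes, without
  forming a quotient type: \<open>q\<close> is the quotient norm and \<open>eqv\<close> below is
  equality of classes. The instance is the distance to a maximal ideal.\<close>

locale algebra_seminorm =
  fixes q :: "'a::complex_comm_banach_algebra_1 \<Rightarrow> real"
  assumes q_add: "q (x + y) \<le> q x + q y"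
    and q_mult: "q (x * y) \<le> q x * q y"
    and q_cc: "q (cc z * x) = cmod z * q x"
    and q_one: "q 1 > 0"
begin

lemma q_zero [simp]: "q 0 = 0"
  using q_cc[of 0 0] by simp

lemma q_minus [simp]: "q (- x) = q x"
  using q_cc[of "-1" x] by (simp add: cc_minus)

lemma q_diff: "q (x - y) \<le> q x + q y"
  using q_add[of x "- y"] by simp

lemma q_nonneg: "q x \<ge> 0"
  using q_add[of x "- x"] by simp

lemma q_commute: "q (x - y) = q (y - x)"
  using q_minus[of "x - y"] by simp

lemma q_one_ge: "q 1 \<ge> 1"
  using q_mult[of 1 1] q_one by simp

text \<open>Exponents start at 1 because \<open>q 1\<close> may exceed 1.\<close>

lemma q_power: "q (x ^ Suc n) \<le> q x ^ Suc n"
proof (induction n)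
  case (Suc n)
  have "q (x ^ Suc (Suc n)) \<le> q x * q (x ^ Suc n)"
    using q_mult[of x "x ^ Suc n"] by simp
  also have "\<dots> \<le> q x * q x ^ Suc n"
    using Suc q_nonneg by (intro mult_left_mono)
  finally show ?case by simp
qed simp

lemma q_sum: "q (\<Sum>i\<in>S. f i) \<le> (\<Sum>i\<in>S. q (f i))"
proof (induction S rule: infinite_finite_induct)
  case (insert x F)
  then show ?case using q_add[of "f x" "sum f F"] by simp
qed auto

definition eqv :: "'a \<Rightarrow> 'a \<Rightarrow> bool" where
  "eqv x y \<longleftrightarrow> q (x - y) = 0"

lemma eqv_q: "eqv x y \<Longrightarrow> q x = q y"
  using q_add[of "x - y" y] q_add[of "y - x" x] q_commute[of x y]
  by (simp add: eqv_def)

lemma eqv_refl [simp]: "eqv x x"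
  by (simp add: eqv_def)

lemma eqv_trans [trans]: "eqv x y \<Longrightarrow> eqv y z \<Longrightarrow> eqv x z"
  using q_add[of "x - y" "y - z"] q_nonneg[of "x - z"] by (simp add: eqv_def)

lemma eqv_mult_left: "eqv x y \<Longrightarrow> eqv (z * x) (z * y)"
  using q_mult[of z "x - y"] q_nonneg[of "z * x - z * y"] by (simp add: eqv_def algebra_simps)

lemma eqv_add: "eqv x y \<Longrightarrow> eqv x' y' \<Longrightarrow> eqv (x + x') (y + y')"
  using q_add[of "x - y" "x' - y'"] q_nonneg[of "x + x' - (y + y')"]
  by (simp add: eqv_def algebra_simps)

lemma eqv_diff: "eqv x y \<Longrightarrow> eqv x' y' \<Longrightarrow> eqv (x - x') (y - y')"
  using q_diff[of "x - y" "x' - y'"] q_nonneg[of "x - x' - (y - y')"]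
  by (simp add: eqv_def algebra_simps)

lemma eqv_mult: "eqv x y \<Longrightarrow> eqv x' y' \<Longrightarrow> eqv (x * x') (y * y')"
  using eqv_mult_left[of x' y' x] eqv_mult_left[of x y y'] eqv_trans
  by (metis mult.commute)

lemma eqv_sum: "(\<And>i. i \<in> S \<Longrightarrow> eqv (f i) (g i)) \<Longrightarrow> eqv (\<Sum>i\<in>S. f i) (\<Sum>i\<in>S. g i)"
  by (induction S rule: infinite_finite_induct) (auto intro: eqv_add)

end

lemma sum_root_unity_powers:
  fixes n j :: nat
  assumes "0 < j" "j < n"
  shows "(\<Sum>k<n. cis (2 * pi * k / n) ^ j) = 0"
proof -
  define w where "w = cis (2 * pi * j / n)"
  have "cis (2 * pi * k / n) ^ j = w ^ k" for k
    by (simp only: w_def Complex.DeMoivre) (rule arg_cong[of _ _ cis], simp)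
  moreover have "w \<noteq> 1"
  proof
    assume "w = 1"
    then have "cos (2 * pi * j / n) = 1"
      by (metis w_def cis.simps(1) one_complex.simps(1))
    then obtain m :: int where "2 * pi * j / n = m * 2 * pi"
      using cos_one_2pi_int by auto
    then have "real j = m * n"
      using assms by (simp add: field_simps)
    then have "int j = m * int n"
      by (metis of_int_eq_iff of_int_mult of_int_of_nat_eq)
    then have "int n dvd int j" by simp
    then show False
      using assms by (auto dest: dvd_imp_le)
  qed
  moreover have "w ^ n = 1"
  proof -
    have "real n * (2 * pi * j / n) = 2 * pi * real j"
      using assms by simp
    then show ?thesis
      by (simp only: w_def Complex.DeMoivre cis_multiple_2pi Ints_of_nat)
  qed
  ultimately show ?thesis
    using geometric_sum[of w n] by simp
qed


context algebra_seminorm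
begin

lemma eqv_power: "eqv x y \<Longrightarrow> eqv (x ^ n) (y ^ n)"
  by (induction n) (auto intro: eqv_mult)

text \<open>
  The averages of \<open>(1 - \<omega> t x)\<inverse>\<close> over the \<open>n\<close>-th roots of unity \<open>\<omega>\<close> equal \<open>(1 - (t x)\<^sup>n)\<inverse>\<close>
  and are Lipschitz in \<open>t\<close> uniformly in \<open>n\<close>. Hence smallness of some power of \<open>t x\<close> propagates from
  \<open>t = 0\<close> to all \<open>t\<close> in steps of fixed length.
\<close>

theorem gelfand_mazur: "\<exists>z. \<not> (\<exists>y. eqv ((x - cc z) * y) 1)"
proof (rule ccontr)
  assume "\<not> ?thesis"
  then obtain R where R: "\<And>z. eqv ((x - cc z) * R z) 1"
    by metis
  have "\<exists>s. eqv ((1 - cc z * x) * s) 1" for z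
  proof (cases "z = 0")
    case False
    then have "cc z * cc (inverse z) = (1::'a)"
      by (simp flip: cc_mult)
    moreover have "(1 - cc z * x) * (- (cc (inverse z) * R (inverse z)))
        = ((cc z * cc (inverse z)) * x - cc (inverse z)) * R (inverse z)"
      by (simp add: algebra_simps)
    ultimately have "(1 - cc z * x) * (- (cc (inverse z) * R (inverse z)))
        = (x - cc (inverse z)) * R (inverse z)"
      by (metis mult_1_left)
    then show ?thesis
      by (metis R)
  qed (auto intro: exI[of _ 1])
  then obtain S where S: "\<And>z. eqv ((1 - cc z * x) * S z) 1"
    by metis
  \<comment> \<open>The resolvent identity for \<open>S z\<close>, the inverse of
    \<open>1 - cc z * x\<close> modulo \<open>eqv\<close>.\<close>
  have S_diff: "q (S z - S w) \<le> cmod (z - w) * (q x * q (S z) * q (S w))" for z w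
  proof -
    have "eqv (S z * ((1 - cc w * x) * S w) - S w * ((1 - cc z * x) * S z)) (S z * 1 - S w * 1)"
      by (intro eqv_diff eqv_mult_left S)
    moreover have "S z * ((1 - cc w * x) * S w) - S w * ((1 - cc z * x) * S z)
        = cc (z - w) * (x * S z * S w)"
      by (simp add: cc_diff algebra_simps)
    ultimately have "q (S z - S w) = cmod (z - w) * q (x * S z * S w)"
      using eqv_q by (metis q_cc mult.right_neutral)
    also have "q (x * S z * S w) \<le> q (x * S z) * q (S w)"
      by (rule q_mult)
    also have "\<dots> \<le> q x * q (S z) * q (S w)"
      by (intro mult_right_mono q_mult q_nonneg)
    finally show ?thesis
      by (simp add: mult_left_mono)
  qed
  \<comment> \<open>\<open>R 0\<close> inverts \<open>x\<close>, so
    \<open>q 1 \<le> q (x ^ n) * T ^ n\<close>: no power of T x can have seminorm below 1. Smallness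
    propagated from 0 up to T is thus contradictory.\<close>
  define T where "T = q (R 0)"
  have xy: "eqv (x * R 0) 1"
    using R[of 0] by simp
  have "1 \<le> q x * T"
    using eqv_q[OF xy] q_one_ge q_mult[of x "R 0"] by (simp add: T_def)
  then have "T \<noteq> 0"
    by auto
  then have T: "T > 0"
    using q_nonneg[of "R 0"] by (simp add: T_def)
  have "\<exists>C\<ge>0. \<forall>z\<in>cball 0 T. q (S z) \<le> C"
  proof -
    \<comment> \<open>On this ball the factor \<open>cmod (z - w) * (q x * q (S w))\<close> is at
      most 1/2, so the resolvent inequality absorbs half of \<open>q (S z)\<close>. Adding 1 keeps
      the denominator positive.\<close>
    define r where "r w = 1 / (2 * (q x * q (S w) + 1))" for w
    have pos: "q x * q (S w) \<ge> 0" for w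
      by (simp add: q_nonneg)
    have r: "r w > 0" for w
      using pos[of w] by (simp add: r_def add_nonneg_pos)
    have loc: "q (S z) \<le> 2 * q (S w)" if "z \<in> ball w (r w)" for z w
    proof -
      have "cmod (z - w) < r w"
        using that by (simp add: dist_norm norm_minus_commute)
      then have "cmod (z - w) * (q x * q (S w)) \<le> r w * (q x * q (S w))"
        by (intro mult_right_mono pos) simp
      also have "\<dots> \<le> 1 / 2"
        using pos[of w] by (simp add: r_def field_simps)
      finally have *: "cmod (z - w) * (q x * q (S w)) * q (S z) \<le> 1 / 2 * q (S z)"
        by (intro mult_right_mono q_nonneg)
      have "q (S z) \<le> q (S z - S w) + q (S w)"
        using q_add[of "S z - S w" "S w"] by simp
      then show ?thesis
        using S_diff[of z w] * by (simp add: mult_ac)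
    qed
    obtain D where D: "finite D" "cball 0 T \<subseteq> (\<Union>w\<in>D. ball w (r w))"
    proof (rule compactE_image[of "cball (0::complex) T" "cball 0 T" "\<lambda>w. ball w (r w)"])
      show "cball 0 T \<subseteq> (\<Union>w\<in>cball 0 T. ball w (r w))"
        using r by force
    qed auto
    have "q (S z) \<le> (\<Sum>w\<in>D. 2 * q (S w))" if z: "z \<in> cball 0 T" for z
    proof -
      obtain w where w: "w \<in> D" "z \<in> ball w (r w)"
        using D z by blast
      then have "q (S z) \<le> 2 * q (S w)"
        using loc by blast
      also have "\<dots> \<le> (\<Sum>w\<in>D. 2 * q (S w))"
        using w D q_nonneg by (intro member_le_sum) auto
      finally show ?thesis .
    qed
    moreover have "(\<Sum>w\<in>D. 2 * q (S w)) \<ge> 0"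
      by (intro sum_nonneg) (simp add: q_nonneg)
    ultimately show ?thesis by blast
  qed
  then obtain C where C: "C \<ge> 0" "\<And>z. z \<in> cball 0 T \<Longrightarrow> q (S z) \<le> C"
    by blast
  define K where "K = q x * C * C"
  have K: "K \<ge> 0"
    using C q_nonneg by (simp add: K_def)
  have S_lip: "q (S z - S w) \<le> K * cmod (z - w)" if "z \<in> cball 0 T" "w \<in> cball 0 T" for z w
  proof -
    have "q x * q (S z) * q (S w) \<le> q x * C * C"
      using C that by (intro mult_mono) (auto simp: q_nonneg)
    then have "cmod (z - w) * (q x * q (S z) * q (S w)) \<le> cmod (z - w) * K"
      unfolding K_def by (intro mult_left_mono) auto
    then show ?thesis
      using S_diff[of z w] by (simp add: mult.commute)
  qed
  define om where "om n k = cis (2 * pi * real k / real n)" for n k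
  define h where "h n t = cc (1 / of_nat n) * (\<Sum>k<n. S (om n k * complex_of_real t))" for n t
  have h_lip: "q (h n s - h n t) \<le> K * \<bar>s - t\<bar>"
    if "n > 0" "0 \<le> s" "s \<le> T" "0 \<le> t" "t \<le> T" for n s t
  proof -
    have "h n s - h n t = cc (1 / of_nat n) *
        (\<Sum>k<n. S (om n k * complex_of_real s) - S (om n k * complex_of_real t))"
      by (simp add: h_def sum_subtractf right_diff_distrib)
    then have "q (h n s - h n t) = 1 / real n *
        q (\<Sum>k<n. S (om n k * complex_of_real s) - S (om n k * complex_of_real t))"
      by (simp add: q_cc norm_divide)
    also have "\<dots> \<le> 1 / real n *
        (\<Sum>k<n. q (S (om n k * complex_of_real s) - S (om n k * complex_of_real t)))"
      by (intro mult_left_mono q_sum) auto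
    also have "\<dots> \<le> 1 / real n * (\<Sum>k<n. K * \<bar>s - t\<bar>)"
    proof (intro mult_left_mono sum_mono)
      fix k
      have "cmod (om n k * complex_of_real s - om n k * complex_of_real t) = \<bar>s - t\<bar>"
        by (simp add: om_def norm_mult flip: right_diff_distrib of_real_diff)
      then show "q (S (om n k * complex_of_real s) - S (om n k * complex_of_real t)) \<le> K * \<bar>s - t\<bar>"
        using S_lip[of "om n k * complex_of_real s" "om n k * complex_of_real t"] that
        by (simp add: om_def norm_mult)
    qed simp
    also have "\<dots> = K * \<bar>s - t\<bar>"
      using that by simp
    finally show ?thesis .
  qed
  have h_inv: "eqv ((1 - (cc (complex_of_real t) * x) ^ n) * h n t) 1" if "n > 0" for n t
  proof -
    define u where "u = cc (complex_of_real t) * x"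
    have om_n: "om n k ^ n = 1" for k
      using that by (simp add: om_def Complex.DeMoivre cis_multiple_2pi)
    have 1: "eqv ((1 - u ^ n) * S (om n k * complex_of_real t)) (\<Sum>j<n. cc (om n k ^ j) * u ^ j)" for k
    proof -
      define v where "v = cc (om n k * complex_of_real t) * x"
      have v: "v = cc (om n k) * u"
        by (simp add: v_def u_def cc_mult mult_ac)
      have "v ^ n = u ^ n"
        by (simp add: v power_mult_distrib om_n flip: cc_power)
      then have "1 - u ^ n = (1 - v) * (\<Sum>j<n. v ^ j)"
        by (metis one_diff_power_eq)
      moreover have "eqv ((\<Sum>j<n. v ^ j) * ((1 - v) * S (om n k * complex_of_real t))) ((\<Sum>j<n. v ^ j) * 1)"
        unfolding v_def by (intro eqv_mult_left S)
      ultimately have "eqv ((1 - u ^ n) * S (om n k * complex_of_real t)) (\<Sum>j<n. v ^ j)"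
        by (simp add: mult_ac)
      then show ?thesis
        by (simp add: v power_mult_distrib cc_power)
    qed
    have "(\<Sum>k<n. \<Sum>j<n. cc (om n k ^ j) * u ^ j) = (\<Sum>j<n. \<Sum>k<n. cc (om n k ^ j) * u ^ j)"
      by (rule sum.swap)
    also have "\<dots> = (\<Sum>j<n. cc (\<Sum>k<n. om n k ^ j) * u ^ j)"
      by (simp add: cc_sum sum_distrib_right)
    also have "\<dots> = (\<Sum>j<n. if j = 0 then cc (of_nat n) else 0)"
    proof (intro sum.cong refl)
      fix j assume "j \<in> {..<n}"
      then show "cc (\<Sum>k<n. om n k ^ j) * u ^ j = (if j = 0 then cc (of_nat n) else 0)"
        using sum_root_unity_powers[of j n] by (cases "j = 0") (auto simp: om_def)
    qed
    also have "\<dots> = cc (of_nat n)"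
      using that by simp
    finally have 2: "(\<Sum>k<n. \<Sum>j<n. cc (om n k ^ j) * u ^ j) = cc (of_nat n)" .
    have "eqv (cc (1 / of_nat n) * (\<Sum>k<n. (1 - u ^ n) * S (om n k * complex_of_real t)))
       (cc (1 / of_nat n) * (\<Sum>k<n. \<Sum>j<n. cc (om n k ^ j) * u ^ j))"
      by (intro eqv_mult_left eqv_sum 1)
    moreover have "cc (1 / of_nat n) * cc (of_nat n) = (1::'a)"
      using that by (simp flip: cc_mult)
    moreover have "(1 - u ^ n) * h n t
        = cc (1 / of_nat n) * (\<Sum>k<n. (1 - u ^ n) * S (om n k * complex_of_real t))"
      by (simp only: h_def sum_distrib_left[symmetric] mult.left_commute)
    ultimately have "eqv ((1 - u ^ n) * h n t) 1"
      by (simp only: 2)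
    then show ?thesis
      by (simp only: u_def)
  qed
  define D where "D t \<longleftrightarrow> (\<exists>n>0. q ((cc (complex_of_real t) * x) ^ n) \<le> 1 / 2)" for t
  have step: "D s" if "D t" "0 \<le> t" "t \<le> s" "s \<le> T" "K * (s - t) \<le> 1 / 8" for s t
  proof -
    obtain m where m: "m > 0" "q ((cc (complex_of_real t) * x) ^ m) \<le> 1 / 2"
      using \<open>D t\<close> by (auto simp: D_def)
    \<comment> \<open>The fourth power turns 1/2 into 1/16, so \<open>h n t\<close> is within (1/16)
      / (15/16) = 1/15 of 1. Since 1/15 + 1/8 \<le> 1/4, \<open>h n s\<close> is within 1/4 of 1,
      and solving for the power at \<open>s\<close> gives 1/3, below the required 1/2.\<close>
    define n where "n = m * Suc 3"
    have n: "n > 0"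
      using m by (simp add: n_def)
    define u where "u = (cc (complex_of_real t) * x) ^ n"
    define w where "w = (cc (complex_of_real s) * x) ^ n"
    have "q u \<le> q ((cc (complex_of_real t) * x) ^ m) ^ Suc 3"
      unfolding u_def n_def power_mult by (rule q_power)
    also have "\<dots> \<le> (1 / 2) ^ Suc 3"
      using m by (intro power_mono q_nonneg)
    finally have u: "q u \<le> 1 / 16"
      by (simp add: power_divide)
    have "eqv (h n t - (1 - u) * h n t) (h n t - 1)"
      using h_inv[OF n] unfolding u_def by (intro eqv_diff eqv_refl)
    moreover have "h n t - (1 - u) * h n t = u * (h n t - 1) + u"
      by (simp add: algebra_simps)
    ultimately have "q (h n t - 1) = q (u * (h n t - 1) + u)"
      using eqv_q by metis
    also have "\<dots> \<le> q u * q (h n t - 1) + q u"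
      using q_add[of "u * (h n t - 1)" u] q_mult[of u "h n t - 1"] by simp
    also have "\<dots> \<le> 1 / 16 * q (h n t - 1) + 1 / 16"
      using u by (intro add_mono mult_right_mono q_nonneg) auto
    finally have ht: "q (h n t - 1) \<le> 1 / 15"
      by simp
    have "q (h n s - 1) \<le> q (h n s - h n t) + q (h n t - 1)"
      using q_add[of "h n s - h n t" "h n t - 1"] by simp
    also have "q (h n s - h n t) \<le> 1 / 8"
      using h_lip[OF n, of s t] that by simp
    finally have hs: "q (h n s - 1) \<le> 1 / 4"
      using ht by simp
    have "eqv (h n s - (1 - w) * h n s - w * (h n s - 1)) (h n s - 1 - w * (h n s - 1))"
      using h_inv[OF n] unfolding w_def by (intro eqv_diff eqv_refl)
    moreover have "h n s - (1 - w) * h n s - w * (h n s - 1) = w"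
      by (simp add: algebra_simps)
    ultimately have "q w = q (h n s - 1 - w * (h n s - 1))"
      using eqv_q by metis
    also have "\<dots> \<le> q (h n s - 1) + q w * q (h n s - 1)"
      using q_diff[of "h n s - 1" "w * (h n s - 1)"] q_mult[of w "h n s - 1"] by simp
    also have "\<dots> \<le> 1 / 4 + q w * (1 / 4)"
      using hs by (intro add_mono mult_left_mono q_nonneg) auto
    finally show ?thesis
      using n unfolding D_def w_def by (intro exI[of _ n]) simp
  qed
  obtain N :: nat where N: "8 * K * T < N" "N > 0"
    using reals_Archimedean2[of "max (8 * K * T) 0"]
    by (metis max_less_iff_conj of_nat_0_less_iff)
  have "D (real k * (T / N))" if "k \<le> N" for k
    using that
  proof (induction k)
    case 0
    show ?case
      by (auto simp: D_def intro!: exI[of _ 1])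
  next
    case (Suc k)
    show ?case
    proof (rule step[of "real k * (T / N)"])
      show "D (real k * (T / N))"
        using Suc by simp
      have "real (Suc k) * (T / N) \<le> real N * (T / N)"
        using Suc.prems T by (intro mult_right_mono) auto
      then show "real (Suc k) * (T / N) \<le> T"
        using N by simp
      have "real (Suc k) * (T / N) - real k * (T / N) = T / N"
        by (simp add: distrib_right add_divide_distrib)
      then show "K * (real (Suc k) * (T / N) - real k * (T / N)) \<le> 1 / 8"
        using N by (simp add: divide_simps)
      show "0 \<le> real k * (T / N)"
        using T by simp
      show "real k * (T / N) \<le> real (Suc k) * (T / N)"
        using T by (intro mult_right_mono) auto
    qed
  qed
  from this[of N] have "D T"
    using N by simp
  then obtain n where n: "n > 0" "q ((cc (complex_of_real T) * x) ^ n) \<le> 1 / 2"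
    by (auto simp: D_def)
  have "q ((cc (complex_of_real T) * x) ^ n) = T ^ n * q (x ^ n)"
    using T by (simp add: power_mult_distrib q_cc norm_power flip: cc_power)
  moreover have "q 1 \<le> q (x ^ n) * T ^ n"
  proof -
    obtain k where k: "n = Suc k"
      using n by (metis gr0_implies_Suc)
    have "q 1 = q (x ^ n * R 0 ^ n)"
      using eqv_q[OF eqv_power[OF xy, of n]] by (simp add: power_mult_distrib)
    also have "\<dots> \<le> q (x ^ n) * q (R 0 ^ n)"
      by (rule q_mult)
    also have "\<dots> \<le> q (x ^ n) * T ^ n"
      unfolding T_def k by (intro mult_left_mono q_power q_nonneg)
    finally show ?thesis .
  qed
  ultimately show False
    using n q_one_ge by (simp add: mult.commute)
qed

end

section \<open>Characters and the spectrum\<close>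

abbreviation (input) characters :: "('a::complex_comm_banach_algebra_1 \<Rightarrow> complex) set" where
  "characters \<equiv> maximal_ideal_space"

text \<open>Takes the infimum in one factor at a time, which is how submultiplicativity passes from
  the norm to the distance from an ideal. For \<open>t = 0\<close> nonemptiness of \<open>M\<close>
  is what yields the bound.\<close>

lemma le_infdist_mult:
  assumes "M \<noteq> {}" "t \<ge> 0" "\<And>m. m \<in> M \<Longrightarrow> c \<le> dist x m * t"
  shows "c \<le> infdist x M * t"
proof (cases "t = 0")
  case True
  then show ?thesis using assms by auto
next
  case False
  then have t: "t > 0" using assms by simp
  have "c / t \<le> infdist x M"
    unfolding infdist_notempty[OF assms(1)]
    using assms t by (intro cINF_greatest) (auto simp: divide_simps mult.commute)
  then show ?thesis
    using t by (simp add: divide_simps)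
qed

section \<open>Maximal ideals and their quotients\<close>

lemma ideal_mult: "is_ideal I \<Longrightarrow> x \<in> I \<Longrightarrow> r * x \<in> I"
  by (simp add: is_ideal_def)

lemma ideal_add: "is_ideal I \<Longrightarrow> x \<in> I \<Longrightarrow> y \<in> I \<Longrightarrow> x + y \<in> I"
  by (simp add: is_ideal_def)

lemma ideal_zero: "is_ideal I \<Longrightarrow> 0 \<in> I"
  by (simp add: is_ideal_def)

lemma ideal_diff: "is_ideal I \<Longrightarrow> x \<in> I \<Longrightarrow> y \<in> I \<Longrightarrow> x - y \<in> I"
  using ideal_add[of I x "-1 * y"] ideal_mult[of I y "-1"] by simp

lemma ideal_unit: "is_ideal I \<Longrightarrow> x \<in> I \<Longrightarrow> x * y = 1 \<Longrightarrow> I = UNIV"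
  by (metis ideal_mult mult.commute mult.right_neutral UNIV_eq_I)

lemma maximal_ideal_inverse:
  assumes M: "is_maximal_ideal M" and x: "x \<notin> M"
  shows "\<exists>y. x * y - 1 \<in> M"
proof -
  have I: "is_ideal M"
    using M by (simp add: is_maximal_ideal_def)
  define J where "J = {m + r * x | m r. m \<in> M}"
  have "is_ideal J"
    unfolding is_ideal_def
  proof (intro conjI ballI allI)
    show "0 \<in> J"
      using ideal_zero[OF I] unfolding J_def by (force intro: exI[of _ 0])
  next
    fix u v assume "u \<in> J" "v \<in> J"
    then obtain m r m' r' where "u = m + r * x" "v = m' + r' * x" "m \<in> M" "m' \<in> M"
      by (auto simp: J_def)
    then have "u + v = (m + m') + (r + r') * x" "m + m' \<in> M"
      using ideal_add[OF I] by (auto simp: algebra_simps)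
    then show "u + v \<in> J"
      unfolding J_def by blast
  next
    fix s u assume "u \<in> J"
    then obtain m r where "u = m + r * x" "m \<in> M"
      by (auto simp: J_def)
    then have "s * u = s * m + (s * r) * x" "s * m \<in> M"
      using ideal_mult[OF I] by (auto simp: algebra_simps)
    then show "s * u \<in> J"
      unfolding J_def by blast
  qed
  moreover have "M \<subseteq> J"
  proof
    fix m assume "m \<in> M"
    then have "m = m + 0 * x \<and> m \<in> M" by simp
    then show "m \<in> J" unfolding J_def by blast
  qed
  moreover have "x \<in> J"
  proof -
    have "x = 0 + 1 * x \<and> 0 \<in> M" using ideal_zero[OF I] by simp
    then show ?thesis unfolding J_def by blast
  qed
  ultimately have "J = UNIV"
    using M x unfolding is_maximal_ideal_def by blast
  then obtain m r where "1 = m + r * x" "m \<in> M"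
    unfolding J_def by blast
  then have "x * r - 1 = 0 - m"
    by (simp add: algebra_simps)
  then show ?thesis
    using ideal_diff[OF I ideal_zero[OF I] \<open>m \<in> M\<close>] by metis
qed

text \<open>The set where the distance \<open>q\<close> to \<open>M\<close> vanishes is an ideal
  containing \<open>M\<close>, and it omits 1 because elements at distance less than 1 from 1 are
  invertible; by maximality it equals \<open>M\<close>. So \<open>eqv\<close> is congruence modulo
  \<open>M\<close>, where every nonzero class is invertible, and the non-invertible
  \<open>x - cc z\<close> given by Gelfand-Mazur must lie in \<open>M\<close>.\<close>

lemma maximal_ideal_codim_1:
  fixes M :: "'a::complex_comm_banach_algebra_1 set"
  assumes M: "is_maximal_ideal M"
  shows "\<exists>z. x - cc z \<in> M"
proof -
  have I: "is_ideal M" and proper: "M \<noteq> UNIV"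
    using M by (auto simp: is_maximal_ideal_def)
  have ne: "M \<noteq> {}"
    using ideal_zero[OF I] by blast
  define q where "q x = infdist x M" for x
  have le: "q x \<le> norm (x - m)" if "m \<in> M" for x m
    using infdist_le[OF that, of x] by (simp add: q_def dist_norm)
  have inf: "c \<le> q x * t" if "t \<ge> 0" "\<And>m. m \<in> M \<Longrightarrow> c \<le> norm (x - m) * t" for c x t
    unfolding q_def using that by (intro le_infdist_mult[OF ne]) (auto simp: dist_norm)
  have inf1: "c \<le> q x" if "\<And>m. m \<in> M \<Longrightarrow> c \<le> norm (x - m)" for c x
    using inf[of 1 c x] that by simp
  have cc_le: "q (cc z * x) \<le> cmod z * q x" for z x
  proof -
    have "q (cc z * x) \<le> q x * cmod z"
    proof (rule inf)
      fix m assume "m \<in> M"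
      then have "q (cc z * x) \<le> norm (cc z * x - cc z * m)"
        by (intro le ideal_mult[OF I])
      also have "\<dots> = norm (x - m) * cmod z"
        by (metis norm_cc_mult mult.commute right_diff_distrib)
      finally show "q (cc z * x) \<le> norm (x - m) * cmod z" .
    qed simp
    then show ?thesis by (simp add: mult.commute)
  qed
  interpret algebra_seminorm q
  proof
    fix x y
    have "q (x + y) - q y \<le> q x"
    proof (rule inf1)
      fix m assume m: "m \<in> M"
      have "q (x + y) - norm (x - m) \<le> q y"
      proof (rule inf1)
        fix m' assume "m' \<in> M"
        then have "q (x + y) \<le> norm (x + y - (m + m'))"
          using m by (intro le ideal_add[OF I])
        also have "\<dots> \<le> norm (x - m) + norm (y - m')"
          by (metis add_diff_add norm_triangle_ineq)
        finally show "q (x + y) - norm (x - m) \<le> norm (y - m')" by simp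
      qed
      then show "q (x + y) - q y \<le> norm (x - m)" by simp
    qed
    then show "q (x + y) \<le> q x + q y" by simp
  next
    fix x y
    show "q (x * y) \<le> q x * q y"
    proof (rule inf)
      show "q y \<ge> 0" by (simp add: q_def infdist_nonneg)
      fix m assume m: "m \<in> M"
      have "q (x * y) \<le> q y * norm (x - m)"
      proof (rule inf)
        fix m' assume m': "m' \<in> M"
        have "y * m + x * m' - m * m' \<in> M"
          using m m' by (intro ideal_diff[OF I] ideal_add[OF I] ideal_mult[OF I])
        then have "q (x * y) \<le> norm (x * y - (y * m + x * m' - m * m'))"
          by (rule le)
        also have "x * y - (y * m + x * m' - m * m') = (y - m') * (x - m)"
          by (simp add: algebra_simps)
        also have "norm \<dots> \<le> norm (y - m') * norm (x - m)"
          by (rule norm_mult_ineq)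
        finally show "q (x * y) \<le> norm (y - m') * norm (x - m)" .
      qed simp
      then show "q (x * y) \<le> norm (x - m) * q y"
        by (simp add: mult.commute)
    qed
  next
    fix z x
    show "q (cc z * x) = cmod z * q x"
    proof (cases "z = 0")
      case True
      then show ?thesis
        using ideal_zero[OF I] by (simp add: q_def)
    next
      case False
      have "q x = q (cc (inverse z) * (cc z * x))"
      proof -
        have "cc (inverse z) * (cc z * x) = cc (inverse z * z) * x"
          by (simp only: cc_mult mult.assoc)
        then show ?thesis
          using False by simp
      qed
      also have "\<dots> \<le> cmod (inverse z) * q (cc z * x)"
        by (rule cc_le)
      finally have "cmod z * q x \<le> q (cc z * x)"
        using False by (simp add: norm_inverse norm_divide divide_simps mult.commute)
      then show ?thesis
        using cc_le[of z x] by simp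
    qed
  next
    have "1 \<le> q 1"
    proof (rule inf1)
      fix m assume m: "m \<in> M"
      show "1 \<le> norm (1 - m)"
      proof (rule ccontr)
        assume "\<not> ?thesis"
        then obtain y where "(1 - (1 - m)) * y = 1"
          using neumann_inverse[of "1 - m"] by auto
        then show False
          using ideal_unit[OF I m] proper by simp
      qed
    qed
    then show "q 1 > 0" by simp
  qed
  have M_eq: "q x = 0 \<longleftrightarrow> x \<in> M" for x
  proof -
    define J where "J = {x. q x = 0}"
    have "is_ideal J"
      unfolding is_ideal_def
    proof (intro conjI ballI allI)
      show "0 \<in> J" by (simp add: J_def)
    next
      fix x y assume "x \<in> J" "y \<in> J"
      then show "x + y \<in> J"
        using q_add[of x y] q_nonneg[of "x + y"] by (simp add: J_def)
    next
      fix r x assume "x \<in> J"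
      then show "r * x \<in> J"
        using q_mult[of r x] q_nonneg[of "r * x"] by (simp add: J_def)
    qed
    moreover have "M \<subseteq> J"
      by (auto simp: J_def q_def)
    moreover have "J \<noteq> UNIV"
      using q_one by (auto simp: J_def set_eq_iff intro!: exI[of _ 1])
    ultimately have "J = M"
      using M by (auto simp: is_maximal_ideal_def)
    then show ?thesis by (auto simp: J_def)
  qed
  obtain z where "\<not> (\<exists>y. eqv ((x - cc z) * y) 1)"
    using gelfand_mazur by blast
  then have "x - cc z \<in> M"
    using maximal_ideal_inverse[OF M] by (auto simp: eqv_def M_eq)
  then show ?thesis by blast
qed

lemma maximal_ideal_character:
  fixes M :: "'a::complex_comm_banach_algebra_1 set"
  assumes M: "is_maximal_ideal M"
  obtains \<phi> where "\<phi> \<in> characters" "\<And>x. \<phi> x = 0 \<longleftrightarrow> x \<in> M"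
proof -
  have I: "is_ideal M" and proper: "M \<noteq> UNIV"
    using M by (auto simp: is_maximal_ideal_def)
  obtain \<phi> where \<phi>: "\<And>x. x - cc (\<phi> x) \<in> M"
    using maximal_ideal_codim_1[OF M] by metis
  have uniq: "\<phi> x = z" if "x - cc z \<in> M" for x z
  proof (rule ccontr)
    assume "\<phi> x \<noteq> z"
    then have "cc (z - \<phi> x) * cc (inverse (z - \<phi> x)) = (1::'a)"
      by (simp flip: cc_mult)
    moreover have "cc (z - \<phi> x) \<in> M"
      using ideal_diff[OF I \<phi>[of x] that] by (simp add: cc_diff)
    ultimately show False
      using ideal_unit[OF I] proper by blast
  qed
  have add: "\<phi> (x + y) = \<phi> x + \<phi> y" for x y
    using ideal_add[OF I \<phi>[of x] \<phi>[of y]] by (intro uniq) (simp add: cc_add algebra_simps)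
  have mult: "\<phi> (x * y) = \<phi> x * \<phi> y" for x y
  proof (rule uniq)
    have "y * (x - cc (\<phi> x)) + cc (\<phi> x) * (y - cc (\<phi> y)) \<in> M"
      by (intro ideal_add[OF I] ideal_mult[OF I] \<phi>)
    then show "x * y - cc (\<phi> x * \<phi> y) \<in> M"
      by (simp add: cc_mult algebra_simps)
  qed
  have cc: "\<phi> (cc z) = z" for z
    by (intro uniq) (simp add: ideal_zero[OF I])
  have "\<phi> 1 \<noteq> 0"
    using cc[of 1] by simp
  then have "\<phi> \<in> characters"
    unfolding maximal_ideal_space_def
    by (auto simp: add mult cc scaleC_eq_cc)
  moreover have "\<phi> x = 0 \<longleftrightarrow> x \<in> M" for x
    using \<phi>[of x] uniq[of x 0] by auto
  ultimately show ?thesis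
    using that by blast
qed

lemma non_unit_in_maximal_ideal:
  fixes x :: "'a::comm_ring_1"
  assumes "\<not> x dvd 1"
  shows "\<exists>M. is_maximal_ideal M \<and> x \<in> M"
proof -
  define \<A> where "\<A> = {I. is_ideal I \<and> x \<in> I \<and> 1 \<notin> I}"
  have "range (\<lambda>r. r * x) \<in> \<A>"
  proof -
    have "is_ideal (range (\<lambda>r. r * x))"
      unfolding is_ideal_def
    proof (intro conjI ballI allI)
      show "0 \<in> range (\<lambda>r. r * x)"
        using rangeI[of "\<lambda>r. r * x" 0] by simp
    next
      fix u v assume "u \<in> range (\<lambda>r. r * x)" "v \<in> range (\<lambda>r. r * x)"
      then obtain r s where "u = r * x" "v = s * x"
        by auto
      then have "u + v = (r + s) * x"
        by (simp add: distrib_right)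
      then show "u + v \<in> range (\<lambda>r. r * x)"
        by simp
    next
      fix s u assume "u \<in> range (\<lambda>r. r * x)"
      then obtain r where "u = r * x"
        by auto
      then have "s * u = (s * r) * x"
        by (simp add: mult.assoc)
      then show "s * u \<in> range (\<lambda>r. r * x)"
        by (rule range_eqI)
    qed
    moreover have "x \<in> range (\<lambda>r. r * x)"
      using rangeI[of "\<lambda>r. r * x" 1] by simp
    moreover have "1 \<notin> range (\<lambda>r. r * x)"
    proof
      assume "1 \<in> range (\<lambda>r. r * x)"
      then obtain r where "1 = r * x"
        by blast
      then show False
        using assms by (metis dvd_triv_right)
    qed
    ultimately show ?thesis
      by (simp add: \<A>_def)
  qed
  then have "\<A> \<noteq> {}"
    by blast
  moreover have "\<Union>\<C> \<in> \<A>" if C: "\<C> \<noteq> {}" "subset.chain \<A> \<C>" for \<C>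
  proof -
    have sub: "\<And>I. I \<in> \<C> \<Longrightarrow> is_ideal I \<and> x \<in> I \<and> 1 \<notin> I"
      using C by (auto simp: subset.chain_def \<A>_def)
    have "is_ideal (\<Union>\<C>)"
      unfolding is_ideal_def
    proof (intro conjI ballI allI)
      show "0 \<in> \<Union>\<C>"
        using C sub ideal_zero by auto
    next
      fix u v assume "u \<in> \<Union>\<C>" "v \<in> \<Union>\<C>"
      then obtain I J where IJ: "u \<in> I" "v \<in> J" "I \<in> \<C>" "J \<in> \<C>"
        by blast
      then have "I \<subseteq> J \<or> J \<subseteq> I"
        using C by (auto simp: subset_chain_def)
      then obtain K where "u \<in> K" "v \<in> K" "K \<in> \<C>"
        using IJ by blast
      then show "u + v \<in> \<Union>\<C>"
        using sub ideal_add[of K u v] by auto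
    next
      fix r u assume "u \<in> \<Union>\<C>"
      then show "r * u \<in> \<Union>\<C>"
        using sub ideal_mult[of _ u r] by auto
    qed
    then show ?thesis
      using C sub by (auto simp: \<A>_def)
  qed
  ultimately have "\<exists>M\<in>\<A>. \<forall>X\<in>\<A>. M \<subseteq> X \<longrightarrow> X = M"
    by (rule subset_Zorn_nonempty)
  then obtain M where M: "M \<in> \<A>" "\<And>X. X \<in> \<A> \<Longrightarrow> M \<subseteq> X \<Longrightarrow> X = M"
    by blast
  have "is_maximal_ideal M"
    unfolding is_maximal_ideal_def
  proof (intro conjI allI impI)
    show "is_ideal M" "M \<noteq> UNIV"
      using M by (auto simp: \<A>_def)
    fix J assume J: "is_ideal J \<and> M \<subseteq> J"
    show "J = M \<or> J = UNIV"
    proof (cases "1 \<in> J")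
      case True
      then show ?thesis
        using ideal_unit[of J 1 1] J by simp
    next
      case False
      then show ?thesis
        using M J by (auto simp: \<A>_def)
    qed
  qed
  then show ?thesis
    using M by (auto simp: \<A>_def)
qed

section \<open>Basic properties of a character\<close>

context
  fixes \<phi> :: "'a::complex_comm_banach_algebra_1 \<Rightarrow> complex"
  assumes \<phi>: "\<phi> \<in> characters"
begin

lemma char_add: "\<phi> (x + y) = \<phi> x + \<phi> y"
  and char_mult: "\<phi> (x * y) = \<phi> x * \<phi> y"
  and char_scaleC: "\<phi> (z *\<^sub>C x) = z * \<phi> x"
  using \<phi> by (simp_all add: maximal_ideal_space_def)

lemma char_1: "\<phi> 1 = 1"
proof -
  obtain f where "\<phi> f \<noteq> 0"
    using \<phi> by (auto simp: maximal_ideal_space_def)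
  then show ?thesis
    using char_mult[of 1 f] by simp
qed

lemma char_cc: "\<phi> (cc z) = z"
  by (simp add: cc_def char_scaleC char_1)

lemma char_0: "\<phi> 0 = 0"
  using char_add[of 0 0] by simp

lemma char_minus: "\<phi> (- x) = - \<phi> x"
  using char_add[of x "- x"] char_0 by (simp add: eq_neg_iff_add_eq_0 add.commute)

lemma char_diff: "\<phi> (x - y) = \<phi> x - \<phi> y"
  using char_add[of x "- y"] char_minus by simp

lemma char_power: "\<phi> (x ^ n) = \<phi> x ^ n"
  by (induction n) (simp_all add: char_1 char_mult)

lemma char_scaleR: "\<phi> (r *\<^sub>R x) = r * \<phi> x"
  by (simp add: scaleR_scaleC char_scaleC)

lemmas char_simps = char_add char_mult char_scaleC char_1 char_cc char_0 char_minus char_diff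
  char_power char_scaleR

lemma char_unit: "x dvd 1 \<Longrightarrow> \<phi> x \<noteq> 0"
  by (metis char_1 char_mult dvd_def mult_zero_left zero_neq_one)

lemma char_in_spectrum: "\<phi> x \<in> spectrum x"
proof -
  have "\<phi> ((\<phi> x *\<^sub>C 1 - x) * y) = 0" for y
    by (simp add: char_simps)
  then have "(\<phi> x *\<^sub>C 1 - x) * y \<noteq> 1" for y
    using char_1 by (metis zero_neq_one)
  then show ?thesis
    by (simp add: spectrum_def)
qed

lemma char_bound: "cmod (\<phi> x) \<le> norm x"
  using char_in_spectrum spectrum_bound by blast

lemma char_bounded_linear: "bounded_linear \<phi>"
  by (rule bounded_linear_intro[of _ 1])
    (auto simp: char_simps char_bound scaleR_conv_of_real)

lemma char_kernel_maximal: "is_maximal_ideal {x. \<phi> x = 0}"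
  unfolding is_maximal_ideal_def
proof (intro conjI allI impI)
  show "is_ideal {x. \<phi> x = 0}"
    by (auto simp: is_ideal_def char_simps)
  show "{x. \<phi> x = 0} \<noteq> UNIV"
    using char_1 by (auto simp: set_eq_iff intro!: exI[of _ 1])
  fix J assume J: "is_ideal J \<and> {x. \<phi> x = 0} \<subseteq> J"
  show "J = {x. \<phi> x = 0} \<or> J = UNIV"
  proof (cases "J \<subseteq> {x. \<phi> x = 0}")
    case False
    then obtain x where x: "x \<in> J" "\<phi> x \<noteq> 0" by auto
    define c where "c = cc (inverse (\<phi> x)) * x"
    have "1 - c \<in> J"
      using J x by (auto simp: c_def char_simps)
    moreover have "c \<in> J"
      using J x by (simp add: c_def ideal_mult)
    ultimately have "1 \<in> J"
      using ideal_add[of J "1 - c" c] J by simp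
    then show ?thesis
      using ideal_unit[of J 1 1] J by simp
  qed (use J in auto)
qed

end

lemma unit_iff_char:
  "x dvd 1 \<longleftrightarrow> (\<forall>\<phi>\<in>characters. \<phi> x \<noteq> 0)" for x :: "'a::complex_comm_banach_algebra_1"
proof
  assume r: "\<forall>\<phi>\<in>characters. \<phi> x \<noteq> 0"
  show "x dvd 1"
  proof (rule ccontr)
    assume "\<not> x dvd 1"
    then obtain M where M: "is_maximal_ideal M" "x \<in> M"
      using non_unit_in_maximal_ideal by blast
    obtain \<phi> where "\<phi> \<in> characters" "\<And>x. \<phi> x = 0 \<longleftrightarrow> x \<in> M"
      using maximal_ideal_character[OF M(1)] by metis
    then show False
      using r M by blast
  qed
qed (auto dest: char_unit)

lemma spectrum_eq: "spectrum x = (\<lambda>\<phi>. \<phi> x) ` characters"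
proof
  show "(\<lambda>\<phi>. \<phi> x) ` characters \<subseteq> spectrum x"
    using char_in_spectrum by blast
  show "spectrum x \<subseteq> (\<lambda>\<phi>. \<phi> x) ` characters"
  proof
    fix z assume "z \<in> spectrum x"
    then have "\<not> (cc z - x) dvd 1"
      by (auto simp: spectrum_def cc_def dvd_def)
    then obtain \<phi> where "\<phi> \<in> characters" "\<phi> (cc z - x) = 0"
      using unit_iff_char by blast
    then show "z \<in> (\<lambda>\<phi>. \<phi> x) ` characters"
      by (auto simp: char_simps)
  qed
qed

lemma characters_nonempty: "(characters :: ('a::complex_comm_banach_algebra_1 \<Rightarrow> complex) set) \<noteq> {}"
  using unit_iff_char[of "0::'a"] by auto

lemma jacobson_radical_eq:
  "(jacobson_radical :: 'a::complex_comm_banach_algebra_1 set) = {x. \<forall>\<phi>\<in>characters. \<phi> x = 0}"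
proof (intro set_eqI iffI)
  fix x :: 'a assume "x \<in> jacobson_radical"
  then show "x \<in> {x. \<forall>\<phi>\<in>characters. \<phi> x = 0}"
    using char_kernel_maximal by (auto simp: jacobson_radical_def)
next
  fix x :: 'a assume "x \<in> {x. \<forall>\<phi>\<in>characters. \<phi> x = 0}"
  then show "x \<in> jacobson_radical"
    unfolding jacobson_radical_def
    by (metis (mono_tags, lifting) InterI maximal_ideal_character mem_Collect_eq)
qed

lemma semisimple_iff_separating:
  "semisimple TYPE('a::complex_comm_banach_algebra_1) \<longleftrightarrow>
     (\<forall>x y::'a. (\<forall>\<phi>\<in>characters. \<phi> x = \<phi> y) \<longrightarrow> x = y)"
proof
  assume s: "semisimple TYPE('a)"
  show "\<forall>x y::'a. (\<forall>\<phi>\<in>characters. \<phi> x = \<phi> y) \<longrightarrow> x = y"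
  proof (intro allI impI)
    fix x y :: 'a assume "\<forall>\<phi>\<in>characters. \<phi> x = \<phi> y"
    then have "x - y \<in> jacobson_radical"
      by (simp add: jacobson_radical_eq char_simps)
    then have "x - y \<in> {0}"
      using s unfolding semisimple_def by metis
    then show "x = y"
      by simp
  qed
next
  assume sep: "\<forall>x y::'a. (\<forall>\<phi>\<in>characters. \<phi> x = \<phi> y) \<longrightarrow> x = y"
  have "x = 0" if "\<forall>\<phi>\<in>characters. \<phi> x = 0" for x :: 'a
    using sep[rule_format, of x 0] that by (simp add: char_0)
  then show "semisimple TYPE('a)"
    unfolding semisimple_def jacobson_radical_eq by (auto simp: char_0)
qed

section \<open>A multiplicative Mazur--Ulam theorem\<close>

lemma exp_element_exists:
  fixes x :: "'a::complex_comm_banach_algebra_1"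
  shows "\<exists>e. \<forall>\<phi>\<in>characters. \<phi> e = exp (\<phi> x)"
proof -
  have s: "summable (\<lambda>n. x ^ n /\<^sub>R fact n)"
  proof (rule summable_comparison_test)
    show "\<exists>N. \<forall>n\<ge>N. norm (x ^ n /\<^sub>R fact n) \<le> norm (1::'a) * (inverse (fact n) * norm x ^ n)"
      using norm_power_le[of x] by (auto simp: divide_simps)
    show "summable (\<lambda>n. norm (1::'a) * (inverse (fact n) * norm x ^ n))"
      by (intro summable_mult summable_exp)
  qed
  have "\<phi> (\<Sum>n. x ^ n /\<^sub>R fact n) = exp (\<phi> x)" if "\<phi> \<in> characters" for \<phi>
  proof -
    have "\<phi> (\<Sum>n. x ^ n /\<^sub>R fact n) = (\<Sum>n. \<phi> (x ^ n /\<^sub>R fact n))"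
      using bounded_linear.suminf[OF char_bounded_linear[OF that] s] by simp
    also have "\<dots> = exp (\<phi> x)"
      using that by (simp add: exp_def char_simps scaleR_conv_of_real)
    finally show ?thesis .
  qed
  then show ?thesis by blast
qed

text \<open>
  The library exponential requires a unit of norm \<open>1\<close>. The element chosen here is unique if the
  algebra is semisimple.
\<close>

definition aexp :: "'a::complex_comm_banach_algebra_1 \<Rightarrow> 'a" where
  "aexp x = (SOME e. \<forall>\<phi>\<in>characters. \<phi> e = exp (\<phi> x))"

lemma char_aexp: "\<phi> \<in> characters \<Longrightarrow> \<phi> (aexp x) = exp (\<phi> x)"
  unfolding aexp_def using someI_ex[OF exp_element_exists[of x]] by blast

lemma aexp_unit: "aexp x dvd 1"
  by (simp add: unit_iff_char char_aexp)

section \<open>Units, and maps preserving the spectra of their quotients\<close>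

definition uinv :: "'a::comm_ring_1 \<Rightarrow> 'a" where
  "uinv x = (SOME y. x * y = 1)"

lemma mult_uinv: "x dvd 1 \<Longrightarrow> x * uinv x = 1"
  unfolding uinv_def by (rule someI_ex) (auto simp: dvd_def)

lemma uinv_cancel:
  assumes "x dvd 1"
  shows "x * y * uinv x = y" "y * x * uinv x = y"
proof -
  show "y * x * uinv x = y"
    using mult_uinv[OF assms] by (simp add: mult.assoc)
  then show "x * y * uinv x = y"
    by (simp only: mult.commute[of x y])
qed

lemma uinv_unit: "x dvd 1 \<Longrightarrow> uinv x dvd 1"
  by (metis mult_uinv dvd_triv_right)

lemma unit_mult: "x dvd 1 \<Longrightarrow> y dvd 1 \<Longrightarrow> x * y dvd (1::'a::comm_ring_1)"
  using mult_dvd_mono[of x 1 y 1] by simp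

lemma char_uinv: "\<phi> \<in> characters \<Longrightarrow> x dvd 1 \<Longrightarrow> \<phi> (uinv x) = inverse (\<phi> x)"
  by (metis char_1 char_mult inverse_unique mult_uinv)

text \<open>For a unit \<open>y\<close> this is the spectrum of \<open>x * uinv y\<close>. It serves
  as a multiplicative distance: units are close when all their ratios are close to 1.\<close>

definition ratios :: "'a::complex_comm_banach_algebra_1 \<Rightarrow> 'a \<Rightarrow> complex set" where
  "ratios x y = (\<lambda>\<phi>. \<phi> x / \<phi> y) ` characters"

text \<open>The multiplicative counterpart of a surjective isometry, on the groups of units; values
  off the units are left free.\<close>

definition ratio_iso ::
    "('a::complex_comm_banach_algebra_1 \<Rightarrow> 'b::complex_comm_banach_algebra_1) \<Rightarrow> bool" where
  "ratio_iso V \<longleftrightarrow> bij_betw V {x. x dvd 1} {y. y dvd 1} \<and>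
     (\<forall>x y. x dvd 1 \<longrightarrow> y dvd 1 \<longrightarrow> ratios (V x) (V y) = ratios x y)"

lemma ratio_iso_unit: "ratio_iso V \<Longrightarrow> x dvd 1 \<Longrightarrow> V x dvd 1"
  by (auto simp: ratio_iso_def bij_betw_def)

lemma ratio_iso_ratios:
  "ratio_iso V \<Longrightarrow> x dvd 1 \<Longrightarrow> y dvd 1 \<Longrightarrow> ratios (V x) (V y) = ratios x y"
  by (simp add: ratio_iso_def)

definition ratio_inv ::
    "('a::complex_comm_banach_algebra_1 \<Rightarrow> 'b::complex_comm_banach_algebra_1) \<Rightarrow> 'b \<Rightarrow> 'a" where
  "ratio_inv V = inv_into {x. x dvd 1} V"

lemma ratio_inv_left: "ratio_iso V \<Longrightarrow> x dvd 1 \<Longrightarrow> ratio_inv V (V x) = x"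
  unfolding ratio_inv_def ratio_iso_def by (metis bij_betw_inv_into_left mem_Collect_eq)

lemma ratio_inv_right: "ratio_iso V \<Longrightarrow> y dvd 1 \<Longrightarrow> V (ratio_inv V y) = y"
  unfolding ratio_inv_def ratio_iso_def by (metis bij_betw_inv_into_right mem_Collect_eq)

lemma ratio_iso_inv:
  assumes "ratio_iso V" shows "ratio_iso (ratio_inv V)"
proof -
  have b: "bij_betw (ratio_inv V) {y. y dvd 1} {x. x dvd 1}"
    using assms unfolding ratio_inv_def ratio_iso_def by (blast intro: bij_betw_inv_into)
  have u: "ratio_inv V y dvd 1" if "y dvd 1" for y
    using b that by (auto simp: bij_betw_def)
  have "ratios (ratio_inv V x) (ratio_inv V y) = ratios x y" if "x dvd 1" "y dvd 1" for x y
    using ratio_iso_ratios[OF assms u[OF that(1)] u[OF that(2)]] ratio_inv_right[OF assms] that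
    by simp
  then show ?thesis
    using b by (simp add: ratio_iso_def)
qed

lemma uinv_reflect:
  assumes "p dvd 1" "x dvd (1::'a::comm_ring_1)"
  shows "p * uinv (p * uinv x) = x"
proof -
  define y where "y = p * uinv x"
  have "y dvd 1"
    using assms by (simp add: y_def unit_mult uinv_unit)
  then have "y * x * uinv y = x"
    using mult_uinv[of y] by (simp add: mult.commute mult.left_commute)
  moreover have "y * x = p"
    using mult_uinv[OF assms(2)] by (simp add: y_def mult.commute mult.left_commute)
  ultimately show ?thesis
    by (simp add: y_def)
qed

lemma ratios_reflect:
  assumes "p dvd 1" "x dvd 1" "y dvd 1"
  shows "ratios (p * uinv x) (p * uinv y) = ratios y x"
  unfolding ratios_def
  using assms by (intro image_cong refl) (simp add: char_mult char_uinv char_unit divide_simps)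

text \<open>
  Vaisala's proof of the Mazur--Ulam theorem, in multiplicative notation: \<open>x \<mapsto> a b / x\<close> is the
  reflection of the group of units at the midpoint \<open>c\<close> of \<open>a\<close> and \<open>b\<close>.
\<close>

lemma ratio_iso_reflected:
  fixes V :: "'a::complex_comm_banach_algebra_1 \<Rightarrow> 'b::complex_comm_banach_algebra_1"
  assumes V: "ratio_iso V" and u: "a dvd 1" "b dvd 1" "c dvd 1" and c: "c * c = a * b"
  obtains W :: "'a \<Rightarrow> 'a" where "ratio_iso W" "W a = a" "W b = b"
    "ratios (W c) c = (\<lambda>\<phi>. \<phi> (V c) ^ 2 / (\<phi> (V a) * \<phi> (V b))) ` characters"
proof -
  define p where "p = a * b"
  define p' where "p' = V a * V b"
  have p: "p dvd 1" "p' dvd 1"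
    using u ratio_iso_unit[OF V] by (simp_all add: p_def p'_def unit_mult)
  \<comment> \<open>Apply \<open>V\<close>, reflect in the range by \<open>p'\<close>, return by the
    inverse of \<open>V\<close>, and reflect in the domain by \<open>p\<close>. Each reflection
    reverses ratios, so two of them preserve ratios. The range reflection exchanges
    \<open>V a\<close> and \<open>V b\<close>, the domain reflection exchanges \<open>a\<close> and
    \<open>b\<close>.\<close>
  define W where "W x = p * uinv (ratio_inv V (p' * uinv (V x)))" for x
  have inv: "ratio_iso (ratio_inv V)"
    by (rule ratio_iso_inv[OF V])
  have u1: "p' * uinv (V x) dvd 1" if "x dvd 1" for x
    using that p V by (simp add: unit_mult uinv_unit ratio_iso_unit)
  have u2: "ratio_inv V (p' * uinv (V x)) dvd 1" if "x dvd 1" for x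
    using u1[OF that] inv by (rule ratio_iso_unit[rotated])
  have u3: "W x dvd 1" if "x dvd 1" for x
    using u2[OF that] p by (simp add: W_def unit_mult uinv_unit)
  define W' where "W' x = ratio_inv V (p' * uinv (V (p * uinv x)))" for x
  have W': "W' x dvd 1" if "x dvd 1" for x
    using that p u2 by (simp add: W'_def unit_mult uinv_unit)
  have W'W: "W' (W x) = x" if "x dvd 1" for x
    using that u1[OF that] u2[OF that] p V
    by (simp add: W'_def W_def uinv_reflect ratio_inv_right ratio_inv_left ratio_iso_unit)
  have WW': "W (W' x) = x" if "x dvd 1" for x
  proof -
    have "p * uinv x dvd 1"
      using that p by (simp add: unit_mult uinv_unit)
    then show ?thesis
      using that u1[of "p * uinv x"] p V
      by (simp add: W'_def W_def uinv_reflect ratio_inv_right ratio_inv_left ratio_iso_unit)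
  qed
  have "bij_betw W {x. x dvd 1} {x. x dvd 1}"
    by (rule bij_betw_byWitness[of _ W']) (auto simp: W'W WW' u3 W')
  moreover have "ratios (W x) (W y) = ratios x y" if "x dvd 1" "y dvd 1" for x y
  proof -
    have "ratios (W x) (W y) = ratios (p' * uinv (V y)) (p' * uinv (V x))"
      unfolding W_def using that p u1 u2 inv by (simp add: ratios_reflect ratio_iso_ratios)
    also have "\<dots> = ratios x y"
      using that p V by (simp add: ratios_reflect ratio_iso_ratios ratio_iso_unit)
    finally show ?thesis .
  qed
  ultimately have "ratio_iso W"
    by (simp add: ratio_iso_def)
  moreover have "W a = a" "W b = b"
  proof -
    have ab: "p * uinv a = b" "p * uinv b = a" "p' * uinv (V a) = V b" "p' * uinv (V b) = V a"
      using u ratio_iso_unit[OF V] by (simp_all add: p_def p'_def uinv_cancel)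
    show "W a = a" "W b = b"
      using u V by (simp_all add: W_def ab ratio_inv_left)
  qed
  moreover have "ratios (W c) c = (\<lambda>\<phi>. \<phi> (V c) ^ 2 / (\<phi> (V a) * \<phi> (V b))) ` characters"
  proof -
    \<comment> \<open>The midpoint is a fixed point of the domain reflection; written this way, both
      arguments of \<open>ratios\<close> are reflected points.\<close>
    have "c = p * uinv c"
      using mult_uinv[OF u(3)] by (simp add: p_def c[symmetric] mult.assoc)
    then have "ratios (W c) c = ratios (W c) (p * uinv c)"
      by simp
    also have "\<dots> = ratios c (ratio_inv V (p' * uinv (V c)))"
      unfolding W_def using p u u2 by (simp add: ratios_reflect)
    also have "\<dots> = ratios (V c) (V (ratio_inv V (p' * uinv (V c))))"
      using u u2 V by (simp add: ratio_iso_ratios)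
    also have "\<dots> = ratios (V c) (p' * uinv (V c))"
      using u u1 V by (simp add: ratio_inv_right)
    also have "\<dots> = (\<lambda>\<phi>. \<phi> (V c) ^ 2 / (\<phi> (V a) * \<phi> (V b))) ` characters"
      unfolding ratios_def p'_def
      using u V
      by (intro image_cong refl)
        (simp add: char_mult char_uinv char_unit ratio_iso_unit power2_eq_square divide_simps)
    finally show ?thesis .
  qed
  ultimately show ?thesis
    using that by blast
qed

text \<open>The bound is proved for all maps fixing \<open>a\<close> and \<open>b\<close> at once,
  so that it may be applied to the reflected map, whose displacement of \<open>c\<close> is the
  square of that of \<open>V\<close>. Passing from \<open>z\<close> to \<open>z ^ 2\<close>
  multiplies the distance to 1 by \<open>cmod (z + 1)\<close>, which is at least 3/2; hence the gain
  of 2/3 per step. The start is the nearness of \<open>a\<close> and \<open>c\<close>, used once in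
  each direction: (9/8)^2 - 1 < 1/2.\<close>

lemma ratio_iso_fixing:
  fixes a b c :: "'a::complex_comm_banach_algebra_1"
  assumes u: "a dvd 1" "b dvd 1" "c dvd 1" and c: "c * c = a * b"
    and near: "\<And>z. z \<in> ratios a c \<Longrightarrow> cmod (z - 1) \<le> 1 / 8"
      "\<And>z. z \<in> ratios c a \<Longrightarrow> cmod (z - 1) \<le> 1 / 8"
  shows "\<lbrakk>ratio_iso V; V a = a; V b = b; z \<in> ratios (V c) c\<rbrakk> \<Longrightarrow> cmod (z - 1) \<le> 1 / 2 * (2 / 3) ^ n"
proof (induction n arbitrary: V z)
  case base: 0
  obtain \<phi> where \<phi>: "\<phi> \<in> characters" "z = \<phi> (V c) / \<phi> c"
    using base by (auto simp: ratios_def)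
  define s where "s = \<phi> (V c) / \<phi> (V a)"
  define t where "t = \<phi> a / \<phi> c"
  have "s \<in> ratios (V c) (V a)"
    using \<phi> by (auto simp: ratios_def s_def)
  then have s: "cmod (s - 1) \<le> 1 / 8"
    using near(2) ratio_iso_ratios[OF base(1) u(3) u(1)] by simp
  have t: "cmod (t - 1) \<le> 1 / 8"
    using near(1) \<phi> by (auto simp: ratios_def t_def)
  have "z = s * t"
    using \<phi> base u by (simp add: s_def t_def char_unit)
  then have "z - 1 = (s - 1) * (t - 1) + (s - 1) + (t - 1)"
    by (simp add: algebra_simps)
  then have "cmod (z - 1) \<le> cmod ((s - 1) * (t - 1)) + cmod (s - 1) + cmod (t - 1)"
    by (metis norm_triangle_mono norm_triangle_ineq order_refl)
  also have "cmod ((s - 1) * (t - 1)) \<le> 1 / 8 * (1 / 8)"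
    unfolding norm_mult using s t by (intro mult_mono) auto
  finally show ?case
    using s t by simp
next
  case (Suc n)
  obtain W where W: "ratio_iso W" "W a = a" "W b = b"
    "ratios (W c) c = (\<lambda>\<phi>. \<phi> (V c) ^ 2 / (\<phi> (V a) * \<phi> (V b))) ` characters"
    by (rule ratio_iso_reflected[OF Suc.prems(1) u c]) blast
  obtain \<phi> where \<phi>: "\<phi> \<in> characters" "z = \<phi> (V c) / \<phi> c"
    using Suc.prems by (auto simp: ratios_def)
  have "\<phi> c * \<phi> c = \<phi> a * \<phi> b"
    using c char_mult[OF \<phi>(1)] by metis
  then have "z ^ 2 \<in> ratios (W c) c"
    using W \<phi> Suc.prems by (auto simp: power_divide power2_eq_square)
  then have "cmod (z ^ 2 - 1) \<le> 1 / 2 * (2 / 3) ^ n"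
    using Suc.IH W by blast
  moreover have "z ^ 2 - 1 = (z - 1) * (z + 1)"
    by (simp add: power2_eq_square algebra_simps)
  ultimately have *: "cmod (z - 1) * cmod (z + 1) \<le> 1 / 2 * (2 / 3) ^ n"
    by (simp add: norm_mult)
  \<comment> \<open>Here the induction hypothesis is used for \<open>V\<close> itself, to keep
    \<open>z\<close> away from -1.\<close>
  have "cmod (z - 1) \<le> 1 / 2"
  proof -
    have "cmod (z - 1) \<le> 1 / 2 * (2 / 3) ^ n"
      using Suc by blast
    also have "\<dots> \<le> 1 / 2 * 1"
      by (intro mult_left_mono power_le_one) auto
    finally show ?thesis by simp
  qed
  then have "3 / 2 \<le> cmod (z + 1)"
    using norm_triangle_ineq2[of 2 "1 - z"] by (simp add: norm_minus_commute add.commute)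
  then have "cmod (z - 1) * (3 / 2) \<le> cmod (z - 1) * cmod (z + 1)"
    by (intro mult_left_mono) auto
  then show ?case
    using * by simp
qed

text \<open>The reflected map \<open>W\<close> fixes \<open>a\<close> and \<open>b\<close>, so the
  bounds for all \<open>n\<close> leave 1 as the only ratio of \<open>W c\<close> to
  \<open>c\<close>. Those ratios measure how far \<open>V c\<close> is from being a midpoint of
  \<open>V a\<close> and \<open>V b\<close>.\<close>

theorem ratio_iso_midpoint:
  fixes V :: "'a::complex_comm_banach_algebra_1 \<Rightarrow> 'b::complex_comm_banach_algebra_1"
  assumes V: "ratio_iso V" and u: "a dvd 1" "b dvd 1" "c dvd 1" and c: "c * c = a * b"
    and near: "\<And>z. z \<in> ratios a c \<Longrightarrow> cmod (z - 1) \<le> 1 / 8"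
      "\<And>z. z \<in> ratios c a \<Longrightarrow> cmod (z - 1) \<le> 1 / 8"
    and \<phi>: "\<phi> \<in> characters"
  shows "\<phi> (V c) ^ 2 = \<phi> (V a) * \<phi> (V b)"
proof -
  obtain W where W: "ratio_iso W" "W a = a" "W b = b"
    "ratios (W c) c = (\<lambda>\<phi>. \<phi> (V c) ^ 2 / (\<phi> (V a) * \<phi> (V b))) ` characters"
    by (rule ratio_iso_reflected[OF V u c]) blast
  define z where "z = \<phi> (V c) ^ 2 / (\<phi> (V a) * \<phi> (V b))"
  have "cmod (z - 1) \<le> 1 / 2 * (2 / 3) ^ n" for n
    using ratio_iso_fixing[OF u c near W(1-3)] W(4) \<phi> by (auto simp: z_def)
  moreover have "(\<lambda>n. 1 / 2 * (2 / 3 :: real) ^ n) \<longlonglongrightarrow> 1 / 2 * 0"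
    by (intro tendsto_mult tendsto_const LIMSEQ_power_zero) auto
  ultimately have "cmod (z - 1) \<le> 1 / 2 * 0"
    using LIMSEQ_le_const by blast
  then have "z = 1"
    by simp
  then show ?thesis
    using \<phi> u V by (auto simp: z_def divide_simps char_unit ratio_iso_unit split: if_splits)
qed


text \<open>The midpoint property makes \<open>f \<mapsto> \<phi> (V (aexp f))\<close> geometric
  along short progressions. Each value is \<open>exp (\<theta> f)\<close> for some character
  \<theta> depending on \<open>f\<close>, so on a small ball the principal logarithm returns
  \<open>\<theta> f\<close>: it is bounded there, additive by the midpoint property, and spectral.
  Dyadic rescaling extends it to the whole algebra. Semisimplicity turns the exponential law, which
  holds at every character, into an equation between elements.\<close>

lemma ratio_iso_log:
  fixes V :: "'a::complex_comm_banach_algebra_1 \<Rightarrow> 'b::complex_comm_banach_algebra_1"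
  assumes ss: "semisimple TYPE('a)" and V: "ratio_iso V" "V 1 = 1" and \<phi>: "\<phi> \<in> characters"
  obtains L where "\<And>f g. L (f + g) = L f + L g" "\<And>f. L f \<in> spectrum f"
    "\<And>f. \<phi> (V (aexp f)) = exp (L f)"
proof -
  have sep: "x = y" if "\<And>\<theta>. \<theta> \<in> characters \<Longrightarrow> \<theta> x = \<theta> y" for x y :: 'a
    using ss that by (auto simp: semisimple_iff_separating)
  define \<zeta> where "\<zeta> f = \<phi> (V (aexp f))" for f
  have "aexp 0 = (1::'a)"
    by (rule sep) (simp add: char_aexp char_simps)
  then have \<zeta>_0: "\<zeta> 0 = 1"
    using V \<phi> by (simp add: \<zeta>_def char_simps)
  have \<zeta>_nz: "\<zeta> f \<noteq> 0" for f
    using V \<phi> aexp_unit[of f] by (simp add: \<zeta>_def char_unit ratio_iso_unit)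
  have \<zeta>_val: "\<exists>\<theta>\<in>characters. \<zeta> f = exp (\<theta> f)" for f
  proof -
    have "\<zeta> f / \<zeta> 0 \<in> ratios (V (aexp f)) (V (aexp 0))"
      using \<phi> by (auto simp: ratios_def \<zeta>_def)
    then have "\<zeta> f \<in> ratios (aexp f) (aexp 0)"
      using V by (simp add: ratio_iso_ratios aexp_unit \<zeta>_0)
    then show ?thesis
      by (auto simp: ratios_def char_aexp char_simps)
  qed
  have "\<exists>\<delta>>0. \<forall>z. dist z 0 < \<delta> \<longrightarrow> dist (exp z) (exp (0::complex)) < 1 / 8"
    using isCont_exp[of "0::complex"] unfolding continuous_at_eps_delta
    by (metis zero_less_divide_1_iff zero_less_numeral)
  then obtain \<delta>0 where \<delta>0: "\<delta>0 > 0" "\<And>z::complex. cmod z < \<delta>0 \<Longrightarrow> cmod (exp z - 1) < 1 / 8"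
    by (auto simp: dist_norm)
  \<comment> \<open>The bound from \<open>\<delta>0\<close> keeps exponentials within the 1/8
    required of midpoints; halving makes the inequality strict. The bound 1, less than pi, keeps
    imaginary parts where \<open>Ln\<close> inverts \<open>exp\<close>, also for a sum of two values
    at elements of norm at most \<open>\<delta> / 2\<close>.\<close>
  define \<delta> where "\<delta> = min (\<delta>0 / 2) 1"
  have \<delta>: "\<delta> > 0" "\<delta> \<le> 1" "\<delta> < \<delta>0"
    using \<delta>0 by (auto simp: \<delta>_def)
  have mid: "\<zeta> f ^ 2 = \<zeta> (f + h) * \<zeta> (f - h)" if "norm h \<le> \<delta>" for f h
    unfolding \<zeta>_def
  proof (rule ratio_iso_midpoint[OF V(1) aexp_unit aexp_unit aexp_unit _ _ _ \<phi>])
    show "aexp f * aexp f = aexp (f + h) * aexp (f - h)"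
      by (rule sep) (simp add: char_simps char_aexp flip: exp_add)
    have *: "cmod (exp (\<theta> h) - 1) \<le> 1 / 8" "cmod (exp (- \<theta> h) - 1) \<le> 1 / 8"
      if "\<theta> \<in> characters" for \<theta>
      using char_bound[OF that, of h] \<open>norm h \<le> \<delta>\<close> \<delta> \<delta>0(2)[of "\<theta> h"] \<delta>0(2)[of "- \<theta> h"]
      by auto
    show "cmod (z - 1) \<le> 1 / 8" if "z \<in> ratios (aexp (f + h)) (aexp f)" for z
      using that * by (auto simp: ratios_def char_simps char_aexp simp flip: exp_diff)
    show "cmod (z - 1) \<le> 1 / 8" if "z \<in> ratios (aexp f) (aexp (f + h))" for z
      using that * by (auto simp: ratios_def char_simps char_aexp simp flip: exp_diff)
  qed
  have pow: "\<zeta> (real k *\<^sub>R h) = \<zeta> h ^ k" if h: "norm h \<le> \<delta>" for k h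
  proof -
    \<comment> \<open>Two consecutive terms are carried through the induction, since the midpoint
      identity is a second-order recursion.\<close>
    have "\<zeta> (real k *\<^sub>R h) = \<zeta> h ^ k \<and> \<zeta> (real (Suc k) *\<^sub>R h) = \<zeta> h ^ Suc k"
    proof (induction k)
      case 0
      then show ?case by (simp add: \<zeta>_0)
    next
      case (Suc k)
      have "\<zeta> (real (Suc k) *\<^sub>R h) ^ 2 = \<zeta> (real (Suc (Suc k)) *\<^sub>R h) * \<zeta> (real k *\<^sub>R h)"
      proof -
        have "real (Suc k) *\<^sub>R h + h = real (Suc (Suc k)) *\<^sub>R h" "real (Suc k) *\<^sub>R h - h = real k *\<^sub>R h"
          by (simp_all add: scaleR_left_distrib scaleR_2)
        then show ?thesis
          using mid[OF h, of "real (Suc k) *\<^sub>R h"] by simp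
      qed
      then have "(\<zeta> h ^ Suc k) ^ 2 = \<zeta> (real (Suc (Suc k)) *\<^sub>R h) * \<zeta> h ^ k"
        using Suc by simp
      then have "\<zeta> h ^ k * (\<zeta> h ^ Suc (Suc k)) = \<zeta> h ^ k * \<zeta> (real (Suc (Suc k)) *\<^sub>R h)"
        by (simp add: power2_eq_square mult_ac)
      then show ?case
        using Suc \<zeta>_nz[of h] by (metis mult_cancel_left power_not_zero)
    qed
    then show ?thesis by blast
  qed
  define l where "l f = Ln (\<zeta> f)" for f
  have exp_l: "exp (l f) = \<zeta> f" for f
    by (simp add: l_def \<zeta>_nz)
  have l_val: "\<exists>\<theta>\<in>characters. l f = \<theta> f" if "norm f \<le> \<delta>" for f
  proof -
    obtain \<theta> where \<theta>: "\<theta> \<in> characters" "\<zeta> f = exp (\<theta> f)"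
      using \<zeta>_val by blast
    have "\<bar>Im (\<theta> f)\<bar> \<le> 1"
      using abs_Im_le_cmod[of "\<theta> f"] char_bound[OF \<theta>(1), of f] that \<delta> by linarith
    then have "Ln (exp (\<theta> f)) = \<theta> f"
      using pi_gt3 by (intro Ln_exp) auto
    then show ?thesis
      using \<theta> by (auto simp: l_def)
  qed
  have l_bound: "cmod (l f) \<le> norm f" if "norm f \<le> \<delta>" for f
    using l_val[OF that] char_bound by metis
  \<comment> \<open>With midpoint \<open>m\<close> of \<open>f\<close> and \<open>g\<close>, the
    square of \<open>\<zeta> m\<close> equals both \<open>\<zeta> f * \<zeta> g\<close> and
    \<open>\<zeta> (f + g)\<close>, the latter because f + g = 2 m.\<close>
  have l_add: "l (f + g) = l f + l g" if f: "norm f \<le> \<delta> / 2" and g: "norm g \<le> \<delta> / 2" for f g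
  proof -
    define m where "m = (1 / 2) *\<^sub>R (f + g)"
    define d where "d = (1 / 2) *\<^sub>R (f - g)"
    have "norm (f + g) \<le> \<delta>" "norm (f - g) \<le> \<delta>"
      using norm_triangle_ineq[of f g] norm_triangle_ineq4[of f g] f g by auto
    then have md: "norm m \<le> \<delta>" "norm d \<le> \<delta>"
      using \<delta> by (auto simp: m_def d_def)
    have half: "(1 / 2) *\<^sub>R x + (1 / 2) *\<^sub>R x = x" for x :: 'a
      by (simp flip: scaleR_left_distrib)
    have "m + d = (1 / 2) *\<^sub>R f + (1 / 2) *\<^sub>R f" "m - d = (1 / 2) *\<^sub>R g + (1 / 2) *\<^sub>R g"
      by (simp_all add: m_def d_def scaleR_right_diff_distrib scaleR_right_distrib)
    moreover have "real 2 *\<^sub>R m = f + g"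
      by (simp add: m_def)
    ultimately have "m + d = f" "m - d = g" "real 2 *\<^sub>R m = f + g"
      by (simp_all only: half)
    then have "\<zeta> (f + g) = \<zeta> f * \<zeta> g"
      using mid[OF md(2), of m] pow[OF md(1), of 2] by simp
    then have "\<zeta> (f + g) = exp (l f + l g)"
      by (simp add: exp_add exp_l)
    moreover have "\<bar>Im (l f + l g)\<bar> \<le> 1"
    proof -
      have "cmod (l f + l g) \<le> norm f + norm g"
        using norm_triangle_ineq[of "l f" "l g"] l_bound[of f] l_bound[of g] f g \<delta> by linarith
      then show ?thesis
        using abs_Im_le_cmod[of "l f + l g"] f g \<delta> by linarith
    qed
    then have "Ln (exp (l f + l g)) = l f + l g"
      using pi_gt3 by (intro Ln_exp) auto
    ultimately show ?thesis
      by (simp add: l_def)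
  qed
  \<comment> \<open>Additivity of \<open>l\<close> near 0 makes \<open>A n f\<close> independent of
    \<open>n\<close> once \<open>f / 2 ^ n\<close> lies in the half-ball, which is what
    \<open>big n f\<close> says. \<open>N\<close> merely selects one such exponent.\<close>
  define A where "A n f = 2 ^ n * l ((1 / 2 ^ n) *\<^sub>R f)" for n :: nat and f
  define big where "big n f \<longleftrightarrow> norm f \<le> 2 ^ n * (\<delta> / 2)" for n :: nat and f :: 'a
  have big_small: "norm ((1 / 2 ^ n) *\<^sub>R f) \<le> \<delta> / 2" if "big n f" for n f
    using that by (simp add: big_def divide_simps mult.commute)
  have A_Suc: "A (Suc n) f = A n f" if "big n f" for n f
  proof -
    define g where "g = (1 / 2 ^ Suc n) *\<^sub>R f"
    have gg: "g + g = (1 / 2 ^ n) *\<^sub>R f"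
      by (simp add: g_def flip: scaleR_add_left)
    have "norm g = norm ((1 / 2 ^ n) *\<^sub>R f) / 2"
      by (simp add: g_def)
    then have "norm g \<le> \<delta> / 2"
      using big_small[OF that] norm_ge_zero[of "(1 / 2 ^ n) *\<^sub>R f"] by linarith
    then have "l ((1 / 2 ^ n) *\<^sub>R f) = l g + l g"
      using l_add[of g g] by (simp only: gg)
    then show ?thesis
      by (simp add: A_def g_def)
  qed
  have big_mono: "big m f" if "big n f" "n \<le> m" for n m f
  proof -
    have "norm f \<le> 2 ^ n * (\<delta> / 2)"
      using that by (simp add: big_def)
    also have "\<dots> \<le> 2 ^ m * (\<delta> / 2)"
      using that \<delta> by (intro mult_right_mono power_increasing) auto
    finally show ?thesis by (simp add: big_def)
  qed
  have A_const: "A m f = A n f" if "big n f" "n \<le> m" for n m f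
    using \<open>n \<le> m\<close>
  proof (induction m rule: dec_induct)
    case (step m)
    then show ?case
      using A_Suc[of m f] big_mono[OF \<open>big n f\<close>] by simp
  qed simp
  have big_ex: "\<exists>n. r \<le> 2 ^ n * (\<delta> / 2)" for r
  proof -
    obtain n where "r / (\<delta> / 2) < 2 ^ n"
      using real_arch_pow[of 2] by auto
    then show ?thesis
      using \<delta> by (intro exI[of _ n]) (simp add: divide_simps)
  qed
  define N where "N f = (SOME n. big n f)" for f
  have big_N: "big (N f) f" for f
  proof -
    have "\<exists>n. big n f"
      using big_ex[of "norm f"] by (simp add: big_def)
    then show ?thesis
      unfolding N_def by (rule someI_ex)
  qed
  define L where "L f = A (N f) f" for f
  have L: "L f = A n f" if "big n f" for n f
    unfolding L_def by (metis A_const that big_N nat_le_linear)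
  show thesis
  proof
    fix f g :: 'a
    obtain n where n: "norm f + norm g \<le> 2 ^ n * (\<delta> / 2)"
      using big_ex by blast
    then have b: "big n f" "big n g" "big n (f + g)"
      using norm_triangle_ineq[of f g] norm_ge_zero[of f] norm_ge_zero[of g] unfolding big_def
      by linarith+
    have "l ((1 / 2 ^ n) *\<^sub>R (f + g)) = l ((1 / 2 ^ n) *\<^sub>R f) + l ((1 / 2 ^ n) *\<^sub>R g)"
      unfolding scaleR_right_distrib by (intro l_add big_small b)
    then show "L (f + g) = L f + L g"
      unfolding L[OF b(1)] L[OF b(2)] L[OF b(3)] A_def by (simp only: distrib_left)
  next
    fix f :: 'a
    define g where "g = (1 / 2 ^ N f) *\<^sub>R f"
    have g: "norm g \<le> \<delta>"
      unfolding g_def using big_small[OF big_N, of f] \<delta> by linarith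
    have fg: "2 ^ N f *\<^sub>R g = f"
      by (simp add: g_def)
    obtain \<theta> where \<theta>: "\<theta> \<in> characters" "l g = \<theta> g"
      using l_val[OF g] by blast
    have "\<theta> f = 2 ^ N f * \<theta> g"
      using char_scaleR[OF \<theta>(1), of "2 ^ N f" g] by (simp add: fg)
    then have "L f = \<theta> f"
      using \<theta> by (simp only: L_def A_def g_def)
    then show "L f \<in> spectrum f"
      using char_in_spectrum[OF \<theta>(1)] by simp
    have "\<zeta> f = \<zeta> g ^ (2 ^ N f)"
      using pow[OF g, of "2 ^ N f"] by (simp add: fg)
    also have "\<dots> = exp (2 ^ N f * l g)"
      using exp_of_nat_mult[of "2 ^ N f" "l g"] by (simp add: exp_l)
    finally show "\<phi> (V (aexp f)) = exp (L f)"
      by (simp only: \<zeta>_def L_def A_def g_def)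
  qed
qed

section \<open>Additive functionals with values in the spectrum\<close>

text \<open>Vieta's formulas for reciprocal roots, with the second elementary symmetric function
  rewritten by Newton's identity in terms of power sums.\<close>

lemma coeffs_prod_linear:
  fixes xs :: "complex list"
  defines "P \<equiv> prod_list (map (\<lambda>r. [:1, - r:]) xs)"
  shows "coeff P 0 = 1" "coeff P 1 = - sum_list xs"
    "2 * coeff P 2 = sum_list xs ^ 2 - sum_list (map (\<lambda>r. r ^ 2) xs)"
proof -
  have "coeff P 0 = 1 \<and> coeff P 1 = - sum_list xs \<and>
      2 * coeff P 2 = sum_list xs ^ 2 - sum_list (map (\<lambda>r. r ^ 2) xs)"
    unfolding P_def
  proof (induction xs)
    case (Cons r xs)
    then show ?case
      by (simp add: coeff_pCons numeral_2_eq_2 power2_eq_square algebra_simps)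
  qed (simp add: coeff_pCons numeral_2_eq_2)
  then show "coeff P 0 = 1" "coeff P 1 = - sum_list xs"
    "2 * coeff P 2 = sum_list xs ^ 2 - sum_list (map (\<lambda>r. r ^ 2) xs)"
    by auto
qed

text \<open>Normalizing the constant coefficient instead of the leading one allows the leading
  coefficient of the expected degree to vanish; the value 1 at 0 makes every root
  invertible.\<close>

lemma poly_reciprocal_factorization:
  fixes P :: "complex poly"
  assumes "poly P 0 = 1"
  shows "\<exists>xs. P = prod_list (map (\<lambda>r. [:1, - r:]) xs) \<and> length xs = degree P"
  using assms
proof (induction "degree P" arbitrary: P)
  case 0
  then obtain c where "P = [:c:]"
    using degree_eq_zeroE by metis
  then show ?case
    using 0 by (intro exI[of _ "[]"]) auto
next
  case (Suc d)
  then have "\<not> constant (poly P)"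
    by (simp add: constant_degree)
  then obtain z where z: "poly P z = 0"
    using fundamental_theorem_of_algebra by blast
  have z0: "z \<noteq> 0"
    using z Suc.prems by auto
  obtain Q where Q: "P = [:- z, 1:] * Q"
    using z by (auto simp: poly_eq_0_iff_dvd)
  define R where "R = smult (- z) Q"
  have "[:1, - inverse z:] * R = smult (- z) [:1, - inverse z:] * Q"
    by (simp only: R_def mult_smult_left mult_smult_right)
  also have "smult (- z) [:1, - inverse z:] = [:- z, 1:]"
    using z0 by simp
  finally have PR: "P = [:1, - inverse z:] * R"
    by (simp add: Q)
  have R0: "poly R 0 = 1"
    using Suc.prems by (simp add: PR)
  have "R \<noteq> 0"
    using R0 by auto
  then have "degree P = Suc (degree R)"
    using z0 unfolding PR by (subst degree_mult_eq) auto
  then obtain xs where "R = prod_list (map (\<lambda>r. [:1, - r:]) xs)" "length xs = degree R"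
    using Suc.hyps(1)[of R] Suc.hyps(2) R0 by auto
  then show ?case
    using PR \<open>degree P = Suc (degree R)\<close> by (intro exI[of _ "inverse z # xs"]) simp
qed

text \<open>
  The argument of Roitman and Sternfeld for the Gleason--Kahane--Zelazko theorem: by the two
  leading Vieta formulas, the reciprocal roots \<open>r\<close> of the polynomial \<open>z \<mapsto> \<psi> ((1 - z x)\<^sup>n)\<close> satisfy
  \<open>\<Sum> r = n \<psi> x\<close> and \<open>\<Sum> r\<^sup>2 = n\<^sup>2 (\<psi> x)\<^sup>2 - n (n - 1) \<psi> (x\<^sup>2)\<close>, while \<open>\<bar>r\<bar> \<le> \<parallel>x\<parallel>\<close>; let \<open>n \<rightarrow> \<infinity>\<close>.
\<close>

lemma gleason_kahane_zelazko_square: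
  fixes \<psi> :: "'a::complex_comm_banach_algebra_1 \<Rightarrow> complex"
  assumes add: "\<And>x y. \<psi> (x + y) = \<psi> x + \<psi> y" and cc: "\<And>z x. \<psi> (cc z * x) = z * \<psi> x"
    and one: "\<psi> 1 = 1"
    and nz: "\<And>z n. cmod z * norm x < 1 \<Longrightarrow> \<psi> ((1 - cc z * x) ^ n) \<noteq> 0"
  shows "\<psi> (x * x) = \<psi> x ^ 2"
proof -
  have zero: "\<psi> 0 = 0"
    using add[of 0 0] by simp
  have sum: "\<psi> (\<Sum>i\<in>S. f i) = (\<Sum>i\<in>S. \<psi> (f i))" for f :: "nat \<Rightarrow> 'a" and S
    by (induction S rule: infinite_finite_induct) (simp_all add: zero add)
  have main: "cmod (of_nat n ^ 2 * \<psi> x ^ 2 - of_nat n * (of_nat n - 1) * \<psi> (x * x))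
      \<le> real n * norm x ^ 2" if n: "n \<ge> 2" for n
  proof -
    define P where "P = (\<Sum>k\<le>n. monom (of_nat (n choose k) * (-1) ^ k * \<psi> (x ^ k)) k)"
    have P: "poly P z = \<psi> ((1 - cc z * x) ^ n)" for z
    proof -
      have "(1 - cc z * x) ^ n = (\<Sum>k\<le>n. of_nat (n choose k) * (- (cc z * x)) ^ k * 1 ^ (n - k))"
        using binomial_ring[of "- (cc z * x)" 1 n] by simp
      also have "\<dots> = (\<Sum>k\<le>n. cc (of_nat (n choose k) * (-1) ^ k * z ^ k) * x ^ k)"
      proof (intro sum.cong refl)
        fix k
        have "- (cc z * x) = cc (- z) * x"
          by (simp add: cc_minus)
        then have "(- (cc z * x)) ^ k = cc ((- z) ^ k) * x ^ k"
          by (simp add: power_mult_distrib cc_power)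
        moreover have "(- z) ^ k = (-1) ^ k * z ^ k"
          by (rule power_minus)
        ultimately show "of_nat (n choose k) * (- (cc z * x)) ^ k * 1 ^ (n - k)
            = cc (of_nat (n choose k) * (-1) ^ k * z ^ k) * x ^ k"
          by (simp only: cc_mult cc_of_nat mult.assoc power_one mult_1_right)
      qed
      finally have "\<psi> ((1 - cc z * x) ^ n) = (\<Sum>k\<le>n. of_nat (n choose k) * (-1) ^ k * z ^ k * \<psi> (x ^ k))"
        by (simp only: sum cc)
      then show ?thesis
        by (simp add: P_def poly_sum poly_monom mult_ac)
    qed
    have coeff: "coeff P j = of_nat (n choose j) * (-1) ^ j * \<psi> (x ^ j)" if "j \<le> n" for j
      using that by (simp add: P_def coeff_sum)
    have "poly P 0 = 1"
      by (simp add: P one)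
    then obtain xs where xs: "P = prod_list (map (\<lambda>r. [:1, - r:]) xs)" "length xs = degree P"
      using poly_reciprocal_factorization by blast
    \<comment> \<open>The degree drops below \<open>n\<close> when
      \<open>\<psi> (x ^ n) = 0\<close>. An upper bound on the number of reciprocal roots suffices
      for estimating the sum of their squares.\<close>
    have "degree P \<le> n"
      unfolding P_def by (intro degree_sum_le) (auto intro: order.trans[OF degree_monom_le])
    then have len: "length xs \<le> n"
      using xs by simp
    have root: "cmod r \<le> norm x" if "r \<in> set xs" for r
    proof (rule ccontr)
      assume "\<not> ?thesis"
      then have r: "norm x < cmod r" "r \<noteq> 0"
        using norm_ge_zero[of x] by auto
      have "[:1, - r:] dvd P"
        unfolding xs using that by (intro prod_list_dvd) auto
      then have "poly P (inverse r) = 0"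
        using r by (auto simp: dvd_def)
      moreover have "cmod (inverse r) * norm x < 1"
        using r by (simp add: norm_inverse norm_divide divide_simps)
      ultimately show False
        using nz P by metis
    qed
    have 1: "sum_list xs = of_nat n * \<psi> x"
      using coeffs_prod_linear(2)[of xs] coeff[of 1] n xs by simp
    have 2: "of_nat n * (of_nat n - 1) * \<psi> (x * x)
        = sum_list xs ^ 2 - sum_list (map (\<lambda>r. r ^ 2) xs)"
    proof -
      have "even (n * (n - 1))"
        by (cases n) auto
      then have "2 * (n choose 2) = n * (n - 1)"
        by (simp add: choose_two)
      then have "(2::complex) * of_nat (n choose 2) = of_nat n * of_nat (n - 1)"
        by (metis of_nat_mult of_nat_numeral)
      then have "2 * coeff P 2 = of_nat n * of_nat (n - 1) * \<psi> (x * x)"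
        using coeff[of 2] n by (simp add: power2_eq_square flip: mult.assoc)
      then show ?thesis
        using coeffs_prod_linear(3)[of xs] n xs by (simp add: of_nat_diff)
    qed
    have "cmod (sum_list (map (\<lambda>r. r ^ 2) xs)) \<le> sum_list (map (\<lambda>r. norm x ^ 2) xs)"
      using root
    proof (induction xs)
      case (Cons r xs)
      have "cmod (r ^ 2) \<le> norm x ^ 2"
        unfolding norm_power using Cons.prems by (intro power_mono) auto
      then show ?case
        using Cons norm_triangle_ineq[of "r ^ 2" "sum_list (map (\<lambda>r. r ^ 2) xs)"] by auto
    qed simp
    also have "\<dots> = real (length xs) * norm x ^ 2"
      by (simp add: sum_list_triv)
    also have "\<dots> \<le> real n * norm x ^ 2"
      using len by (intro mult_right_mono) auto
    finally show ?thesis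
      unfolding 2 1 by (simp add: power_mult_distrib)
  qed
  define D where "D = \<psi> x ^ 2 - \<psi> (x * x)"
  define C where "C = norm x ^ 2 + cmod (\<psi> (x * x))"
  have bound: "real n * cmod D \<le> C" if n: "n \<ge> 2" for n
  proof -
    have "of_nat n ^ 2 * D = (of_nat n ^ 2 * \<psi> x ^ 2 - of_nat n * (of_nat n - 1) * \<psi> (x * x))
        - of_nat n * \<psi> (x * x)"
      by (simp add: D_def power2_eq_square algebra_simps)
    then have "cmod (of_nat n ^ 2 * D) \<le> real n * norm x ^ 2 + cmod (of_nat n * \<psi> (x * x))"
      using main[OF n] norm_triangle_ineq4 by (smt (verit, best))
    then have "real n * (real n * cmod D) \<le> real n * C"
      by (simp add: norm_mult norm_power C_def power2_eq_square distrib_left mult.assoc)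
    then show ?thesis
      using n by simp
  qed
  have "D = 0"
  proof (rule ccontr)
    assume "D \<noteq> 0"
    obtain n :: nat where n: "real n > max 2 (C / cmod D)"
      using reals_Archimedean2 by blast
    then have "C < real n * cmod D"
      using \<open>D \<noteq> 0\<close> by (simp add: divide_simps)
    then show False
      using bound[of n] n by simp
  qed
  then show ?thesis
    by (simp add: D_def)
qed

text \<open>The defect \<open>g\<close> from real homogeneity is additive and vanishes at integers,
  so it depends only on the fractional part and is bounded. Since \<open>g (n * r)\<close> is n
  times \<open>g r\<close>, it must be 0.\<close>

lemma bounded_additive_scaleR:
  fixes L :: "'a::real_normed_vector \<Rightarrow> complex"
  assumes add: "\<And>x y. L (x + y) = L x + L y" and bound: "\<And>x. cmod (L x) \<le> norm x"
  shows "L (r *\<^sub>R x) = of_real r * L x"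
proof -
  define g where "g r = L (r *\<^sub>R x) - of_real r * L x" for r
  have g_add: "g (r + s) = g r + g s" for r s
    by (simp add: g_def add scaleR_left_distrib algebra_simps)
  have g_0: "g 0 = 0"
    using g_add[of 0 0] by simp
  have g_minus: "g (- r) = - g r" for r
    using g_add[of r "- r"] g_0 by (simp add: eq_neg_iff_add_eq_0 add.commute)
  have g_nat: "g (real n * r) = of_nat n * g r" for n r
    by (induction n) (simp_all add: g_0 g_add distrib_right)
  have g_int: "g (of_int k) = 0" for k
  proof -
    have "g 1 = 0"
      by (simp add: g_def)
    then have "g (real n) = 0" for n
      using g_nat[of n 1] by simp
    then show ?thesis
      by (cases k) (simp_all add: g_minus del: of_nat_Suc)
  qed
  have g_bound: "cmod (g r) \<le> 2 * norm x" for r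
  proof -
    have "g r = g (of_int \<lfloor>r\<rfloor> + frac r)"
      by (simp add: frac_def)
    then have gr: "g r = g (frac r)"
      by (simp add: g_add g_int)
    have "cmod (g (frac r)) \<le> cmod (L (frac r *\<^sub>R x)) + cmod (of_real (frac r) * L x)"
      unfolding g_def by (rule norm_triangle_ineq4)
    moreover have "cmod (L (frac r *\<^sub>R x)) \<le> norm x"
      using bound[of "frac r *\<^sub>R x"] frac_lt_1[of r] frac_ge_0[of r] mult_right_mono[of "frac r" 1 "norm x"]
      by simp
    moreover have "cmod (of_real (frac r) * L x) \<le> norm x"
      using bound[of x] frac_lt_1[of r] frac_ge_0[of r] mult_mono[of "frac r" 1 "cmod (L x)" "norm x"]
      by (simp add: norm_mult)
    ultimately show ?thesis
      unfolding gr by linarith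
  qed
  have "g r = 0"
  proof (rule ccontr)
    assume nz: "g r \<noteq> 0"
    obtain n :: nat where "real n > 2 * norm x / cmod (g r)"
      using reals_Archimedean2 by blast
    then have "2 * norm x < real n * cmod (g r)"
      using nz by (simp add: divide_simps)
    then show False
      using g_bound[of "real n * r"] by (simp add: g_nat norm_mult)
  qed
  then show ?thesis
    by (simp add: g_def)
qed

text \<open>
  The additive case of the Kowalski--Slodkowski theorem. On a unit, the complex linear part \<open>\<psi>1\<close>
  and the antilinear part \<open>\<psi>2\<close> of \<open>L\<close> have different moduli, since otherwise \<open>L\<close> vanishes on a
  rotation of the unit. Hence \<open>\<psi>1\<close> dominates on the component of \<open>1\<close>.
\<close>

theorem additive_spectral_character:
  fixes L :: "'a::complex_comm_banach_algebra_1 \<Rightarrow> complex"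
  assumes add: "\<And>x y. L (x + y) = L x + L y" and spec: "\<And>x. L x \<in> spectrum x"
  shows "L \<in> characters"
proof -
  have bound: "cmod (L x) \<le> norm x" for x
    using spec spectrum_bound by blast
  have L_real: "L (cc (of_real r) * x) = of_real r * L x" for r x
    using bounded_additive_scaleR[of L, OF add bound] by (simp add: scaleR_eq_cc)
  have L_cc: "L (cc z * x) = of_real (Re z) * L x + of_real (Im z) * L (cc \<i> * x)" for z x
  proof -
    have "cc z * x = cc (of_real (Re z)) * x + cc (of_real (Im z)) * (cc \<i> * x)"
      by (subst complex_eq) (simp add: cc_add cc_mult algebra_simps)
    then show ?thesis
      by (simp only: add L_real)
  qed
  have L_const: "L (cc z) = z" for z
    using spec[of "cc z"] by (auto simp: spectrum_eq char_cc)
  define \<psi>1 where "\<psi>1 x = (L x - \<i> * L (cc \<i> * x)) / 2" for x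
  define \<psi>2 where "\<psi>2 x = (L x + \<i> * L (cc \<i> * x)) / 2" for x
  have L_eq: "L x = \<psi>1 x + \<psi>2 x" for x
    by (simp add: \<psi>1_def \<psi>2_def field_simps)
  have add1: "\<psi>1 (x + y) = \<psi>1 x + \<psi>1 y" and add2: "\<psi>2 (x + y) = \<psi>2 x + \<psi>2 y" for x y
    by (simp_all add: \<psi>1_def \<psi>2_def add distrib_left field_simps)
  have L_i: "L (cc \<i> * (cc z * x)) = - of_real (Im z) * L x + of_real (Re z) * L (cc \<i> * x)" for z x
    using L_cc[of "\<i> * z" x] by (simp add: cc_mult mult.assoc)
  have cc1: "\<psi>1 (cc z * x) = z * \<psi>1 x" for z x
    unfolding \<psi>1_def L_i L_cc[of z x] by (subst (7) complex_eq) (simp add: field_simps)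
  have cc2: "\<psi>2 (cc z * x) = cnj z * \<psi>2 x" for z x
    unfolding \<psi>2_def L_i L_cc[of z x] complex_eq_iff by (simp add: field_simps)
  have one1: "\<psi>1 1 = 1" and one2: "\<psi>2 1 = 0"
    using L_const[of 1] L_const[of \<i>] by (simp_all add: \<psi>1_def \<psi>2_def)
  have ne: "cmod (\<psi>1 x) \<noteq> cmod (\<psi>2 x)" if x: "x dvd 1" for x
  proof
    assume eq: "cmod (\<psi>1 x) = cmod (\<psi>2 x)"
    have "\<exists>u. cmod u = 1 \<and> u * \<psi>1 x + cnj u * \<psi>2 x = 0"
    proof (cases "\<psi>1 x = 0")
      case True
      then show ?thesis
        using eq by (intro exI[of _ 1]) auto
    next
      case False
      \<comment> \<open>Solves u^2 \<open>\<psi>1 x\<close> = - \<open>\<psi>2 x\<close>. Equal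
        moduli put \<open>u\<close> on the unit circle, so its conjugate is its inverse and
        \<open>L\<close> vanishes at the unit \<open>cc u * x\<close>, against the spectral
        condition.\<close>
      define u where "u = csqrt (- \<psi>2 x / \<psi>1 x)"
      have u2: "u ^ 2 = - \<psi>2 x / \<psi>1 x"
        by (simp add: u_def)
      moreover have "\<psi>2 x \<noteq> 0"
        using eq False by auto
      ultimately have "cmod u ^ 2 = 1"
        using eq False by (simp add: norm_divide flip: norm_power)
      then have u1: "cmod u = 1"
        by (simp add: power2_eq_1_iff) (metis norm_ge_zero not_one_le_zero neg_0_le_iff_le)
      then have "u * cnj u = 1"
        using complex_norm_square[of u] by simp
      then have "u * (u * \<psi>1 x + cnj u * \<psi>2 x) = u ^ 2 * \<psi>1 x + \<psi>2 x"
        by (simp add: distrib_left power2_eq_square flip: mult.assoc)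
      also have "\<dots> = 0"
        using False by (simp add: u2)
      finally show ?thesis
        using u1 by (intro exI[of _ u]) auto
    qed
    then obtain u where u: "cmod u = 1" "u * \<psi>1 x + cnj u * \<psi>2 x = 0"
      by blast
    then have "L (cc u * x) = 0"
      by (simp add: L_eq cc1 cc2)
    then obtain \<theta> where \<theta>: "\<theta> \<in> characters" "\<theta> (cc u * x) = 0"
      using spec[of "cc u * x"] by (auto simp: spectrum_eq)
    then show False
      using u char_unit[OF \<theta>(1) x] by (auto simp: char_simps)
  qed
  have lin: "bounded_linear \<psi>1" "bounded_linear \<psi>2"
  proof -
    have b: "cmod (L (cc \<i> * x)) \<le> norm x" for x
      using bound[of "cc \<i> * x"] by (simp add: norm_cc_mult)
    have "cmod (\<psi>1 x) \<le> norm x * 1" "cmod (\<psi>2 x) \<le> norm x * 1" for x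
      using norm_triangle_ineq4[of "L x" "\<i> * L (cc \<i> * x)"] norm_triangle_ineq[of "L x" "\<i> * L (cc \<i> * x)"]
        bound[of x] b[of x]
      by (auto simp: \<psi>1_def \<psi>2_def norm_divide norm_mult)
    then show "bounded_linear \<psi>1" "bounded_linear \<psi>2"
      by (auto intro!: bounded_linear_intro[of _ 1] simp: add1 add2 cc1 cc2 scaleR_eq_cc scaleR_conv_of_real)
  qed
  \<comment> \<open>The segment from 1 to 1 - z x consists of units, and so do the
    \<open>n\<close>-th powers of its points. The difference of the moduli never vanishes along this
    path and is 1 at its start.\<close>
  have dom: "cmod (\<psi>2 ((1 - cc z * x) ^ n)) < cmod (\<psi>1 ((1 - cc z * x) ^ n))"
    if zx: "cmod z * norm x < 1" for z x n
  proof -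
    define w where "w = cc z * x"
    define y where "y t = (1 - t *\<^sub>R w) ^ n" for t
    define D where "D t = cmod (\<psi>1 (y t)) - cmod (\<psi>2 (y t))" for t
    have "D t \<noteq> 0" if "t \<in> {0..1}" for t
    proof -
      have "norm (t *\<^sub>R w) \<le> 1 * norm w"
        unfolding norm_scaleR using that by (intro mult_right_mono) auto
      then have "norm (t *\<^sub>R w) < 1"
        using zx by (simp add: w_def norm_cc_mult)
      then have "(1 - t *\<^sub>R w) dvd 1"
        using neumann_inverse by (metis dvd_triv_left)
      then have "y t dvd 1"
        using dvd_power_same[of "1 - t *\<^sub>R w" 1 n] by (simp add: y_def)
      then show ?thesis
        using ne by (auto simp: D_def)
    qed
    moreover have "continuous_on {0..1} D"
      unfolding D_def y_def
      by (intro continuous_intros bounded_linear.continuous_on[OF lin(1)] bounded_linear.continuous_on[OF lin(2)])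
    moreover have "D 0 > 0"
      by (simp add: D_def y_def one1 one2)
    ultimately have "D 1 > 0"
      using IVT2'[of D 1 0 0] by (metis atLeastAtMost_iff less_le_not_le linorder_le_less_linear zero_le_one order_le_less)
    then show ?thesis
      by (simp add: D_def y_def w_def)
  qed
  \<comment> \<open>Conjugating \<open>\<psi>2\<close> makes it complex linear, so this combination
    satisfies the hypotheses of the square lemma; \<open>dom\<close> keeps it nonzero for every
    \<open>s\<close> in the closed unit disc.\<close>
  have sq: "\<psi>1 (x * x) + s * cnj (\<psi>2 (x * x)) = (\<psi>1 x + s * cnj (\<psi>2 x)) ^ 2" if s: "cmod s \<le> 1" for s x
  proof (rule gleason_kahane_zelazko_square[where \<psi> = "\<lambda>x. \<psi>1 x + s * cnj (\<psi>2 x)"])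
    fix z n assume "cmod z * norm x < 1"
    then have less: "cmod (\<psi>2 ((1 - cc z * x) ^ n)) < cmod (\<psi>1 ((1 - cc z * x) ^ n))"
      by (rule dom)
    have "cmod (s * cnj (\<psi>2 ((1 - cc z * x) ^ n))) \<le> 1 * cmod (\<psi>2 ((1 - cc z * x) ^ n))"
      unfolding norm_mult complex_mod_cnj using s by (intro mult_right_mono) auto
    then show "\<psi>1 ((1 - cc z * x) ^ n) + s * cnj (\<psi>2 ((1 - cc z * x) ^ n)) \<noteq> 0"
      using less by (metis add_eq_0_iff2 mult_1 norm_minus_cancel not_less)
  qed (simp_all add: add1 add2 cc1 cc2 one1 one2 distrib_left mult.left_commute add_ac)
  have "\<psi>2 x = 0" for x
  proof -
    define p where "p = \<psi>1 x"
    define r where "r = cnj (\<psi>2 x)"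
    \<comment> \<open>Adding the identities for s = 1 and s = -1 and subtracting twice the one for s
      = 0 leaves 2 r^2 = 0.\<close>
    have "\<psi>1 (x * x) = p ^ 2" "\<psi>1 (x * x) + cnj (\<psi>2 (x * x)) = (p + r) ^ 2"
      "\<psi>1 (x * x) - cnj (\<psi>2 (x * x)) = (p - r) ^ 2"
      using sq[of 0 x] sq[of 1 x] sq[of "-1" x] by (simp_all add: p_def r_def)
    then have "r ^ 2 = 0"
      by algebra
    then show ?thesis
      by (simp add: r_def)
  qed
  then have L1: "L x = \<psi>1 x" for x
    by (simp add: L_eq)
  have L_sq: "L (x * x) = L x ^ 2" for x
    using sq[of 0 x] by (simp add: L1)
  have "L (x * y) = L x * L y" for x y
  proof -
    have "(x + y) * (x + y) = x * x + x * y + x * y + y * y"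
      by (simp add: algebra_simps)
    then have "L ((x + y) * (x + y)) = L (x * x) + L (x * y) + L (x * y) + L (y * y)"
      by (simp only: add)
    then have "(L x + L y) ^ 2 = L x ^ 2 + L (x * y) + L (x * y) + L y ^ 2"
      by (simp only: L_sq add)
    then have "2 * L (x * y) = 2 * (L x * L y)"
      by algebra
    then show ?thesis by simp
  qed
  moreover have "L 1 \<noteq> 0"
    using L_const[of 1] by simp
  ultimately show ?thesis
    unfolding maximal_ideal_space_def by (auto simp: add scaleC_eq_cc L_const)
qed

section \<open>Comparison of exponential ranges\<close>

text \<open>For fixed large \<open>M\<close>, a point attaining \<open>w\<close> must have
  \<open>p y ^ N\<close> of modulus above 1/2, as otherwise the exponential makes the value too
  small. Letting \<open>N\<close> grow forces such points towards \<open>y0\<close>. In the limit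
  \<open>w = u y0 * exp (M * (s' - 1))\<close> with \<open>s'\<close> in the unit disc, and
  \<open>w\<close> being at least as large as \<open>u y0\<close> leaves only
  \<open>s' = 1\<close>.\<close>

lemma peak_value_attained:
  fixes u p :: "'x::metric_space \<Rightarrow> complex"
  assumes K: "compact K" "y0 \<in> K" and cont: "continuous_on K u" "continuous_on K p"
    and p: "p y0 = 1" "\<And>y. y \<in> K \<Longrightarrow> y \<noteq> y0 \<Longrightarrow> cmod (p y) < 1"
    and w: "cmod (u y0) \<le> cmod w"
    and att: "\<And>M N. \<exists>y\<in>K. u y * exp (M * (p y ^ N - 1)) = w"
  shows "w = u y0"
proof (rule ccontr)
  assume ne: "w \<noteq> u y0"
  then have w0: "cmod w > 0"
    using w by auto
  have "bounded (u ` K)"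
    using K cont compact_continuous_image compact_imp_bounded by blast
  then obtain C where C: "C > 0" "\<And>y. y \<in> K \<Longrightarrow> cmod (u y) \<le> C"
    by (auto simp: bounded_pos)
  \<comment> \<open>Chosen so that \<open>C * exp (- M / 2) < cmod w\<close>: the factor has modulus
    at most \<open>exp (- M / 2)\<close> wherever \<open>p y ^ N\<close> has modulus at most
    1/2.\<close>
  define M where "M = 2 * \<bar>ln (C / cmod w)\<bar> + 2"
  have M: "M > 0"
    by (simp add: M_def add_nonneg_pos)
  have CM: "C * exp (- M / 2) < cmod w"
  proof -
    have "exp (ln (C / cmod w)) < exp (M / 2)"
      by (simp add: M_def)
    moreover have "exp (ln (C / cmod w)) = C / cmod w"
      using C w0 by (intro exp_ln) simp
    ultimately have "C / cmod w < exp (M / 2)"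
      by simp
    then show ?thesis
      using w0 by (simp add: exp_minus divide_simps mult.commute)
  qed
  have p1: "cmod (p y) \<le> 1" if "y \<in> K" for y
    using p that by (cases "y = y0") (auto intro: less_imp_le)
  have "\<forall>N. \<exists>y\<in>K. u y * exp (of_real M * (p y ^ N - 1)) = w"
    using att by blast
  then obtain y where y: "\<And>N. y N \<in> K" "\<And>N. u (y N) * exp (of_real M * (p (y N) ^ N - 1)) = w"
    by metis
  define s where "s N = p (y N) ^ N" for N
  have s1: "cmod (s N) \<le> 1" for N
    unfolding s_def norm_power using p1[OF y(1)] by (intro power_le_one) auto
  have s2: "cmod (s N) > 1 / 2" for N
  proof (rule ccontr)
    assume "\<not> ?thesis"
    then have "Re (s N) \<le> 1 / 2"
      using complex_Re_le_cmod[of "s N"] by linarith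
    then have "M * (Re (s N) - 1) \<le> M * (- 1 / 2)"
      using M by (intro mult_left_mono) auto
    then have "exp (M * (Re (s N) - 1)) \<le> exp (- M / 2)"
      by simp
    then have "cmod (u (y N)) * exp (M * (Re (s N) - 1)) \<le> C * exp (- M / 2)"
      using C y by (intro mult_mono) auto
    moreover have "cmod w = cmod (u (y N)) * exp (M * (Re (s N) - 1))"
      by (subst y(2)[of N, symmetric]) (simp add: norm_mult s_def)
    ultimately show False
      using CM by simp
  qed
  have "seq_compact (K \<times> cball (0::complex) 1)"
    by (intro compact_imp_seq_compact compact_Times K compact_cball)
  moreover have "\<forall>N. (y N, s N) \<in> K \<times> cball 0 1"
    using y s1 by simp
  ultimately obtain l r where l: "l \<in> K \<times> cball (0::complex) 1" and r: "strict_mono (r :: nat \<Rightarrow> nat)"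
    and lim: "((\<lambda>N. (y N, s N)) \<circ> r) \<longlonglongrightarrow> l"
    by (rule seq_compactE)
  define y' where "y' = fst l"
  define s' where "s' = snd l"
  have y': "y' \<in> K" and s': "cmod s' \<le> 1"
    using l by (auto simp: y'_def s'_def)
  have limy: "(\<lambda>n. y (r n)) \<longlonglongrightarrow> y'" and lims: "(\<lambda>n. s (r n)) \<longlonglongrightarrow> s'"
    using tendsto_fst[OF lim] tendsto_snd[OF lim] by (simp_all add: o_def y'_def s'_def)
  have lim_comp: "(\<lambda>n. g (y (r n))) \<longlonglongrightarrow> g y'" if "continuous_on K g" for g :: "'x \<Rightarrow> complex"
    using continuous_on_tendsto_compose[OF that limy y'] y by simp
  have "y' = y0"
  proof (rule ccontr)
    assume "y' \<noteq> y0"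
    then have lt: "cmod (p y') < 1"
      using p y' by blast
    define q where "q = (1 + cmod (p y')) / 2"
    have q: "cmod (p y') < q" "q < 1" "0 \<le> q"
      using lt by (auto simp: q_def)
    have "\<forall>\<^sub>F n in sequentially. cmod (p (y (r n))) < q"
      using tendsto_norm[OF lim_comp[OF cont(2)]] q(1) by (rule order_tendstoD)
    moreover have "\<forall>\<^sub>F n in sequentially. q ^ r n < 1 / 2"
    proof -
      have "(\<lambda>n. q ^ n) \<longlonglongrightarrow> 0"
        using q by (intro LIMSEQ_realpow_zero) auto
      then have "(\<lambda>n. q ^ r n) \<longlonglongrightarrow> 0"
        using LIMSEQ_subseq_LIMSEQ[OF _ r] by (auto simp: o_def)
      then show ?thesis
        by (rule order_tendstoD) simp
    qed
    ultimately have "\<forall>\<^sub>F n in sequentially. False"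
    proof eventually_elim
      case (elim n)
      have "cmod (s (r n)) \<le> q ^ r n"
        unfolding s_def norm_power using elim by (intro power_mono) auto
      then show False
        using s2[of "r n"] elim by simp
    qed
    then show False by simp
  qed
  then have "(\<lambda>n. u (y (r n)) * exp (of_real M * (s (r n) - 1))) \<longlonglongrightarrow> u y0 * exp (of_real M * (s' - 1))"
    using lim_comp[OF cont(1)] lims by (auto intro!: tendsto_intros)
  then have eq: "u y0 * exp (of_real M * (s' - 1)) = w"
    using y(2) unfolding s_def by (simp add: LIMSEQ_const_iff)
  then have "cmod (u y0) * exp (M * (Re s' - 1)) = cmod w"
    using norm_mult[of "u y0" "exp (of_real M * (s' - 1))"] by simp
  then have "cmod (u y0) * 1 \<le> cmod (u y0) * exp (M * (Re s' - 1))" "u y0 \<noteq> 0"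
    using w w0 by auto
  then have "1 \<le> exp (M * (Re s' - 1))"
    by (metis mult_le_cancel_left_pos zero_less_norm_iff)
  then have "Re s' \<ge> 1"
    using M by (simp add: zero_le_mult_iff)
  then have "Re s' = 1"
    using s' complex_Re_le_cmod[of s'] by linarith
  moreover have "Re s' ^ 2 + Im s' ^ 2 \<le> 1"
    using power_mono[OF s', of 2] by (simp add: cmod_power2)
  ultimately have "s' = 1"
    by (simp add: complex_eq_iff)
  then show False
    using eq ne by simp
qed

text \<open>
  The point of \<open>K\<close> farthest from a centre far away on a normal to the diagonal is exposed and off the
  diagonal, and the affine function \<open>p\<close> peaks there. The factor \<open>exp (M (p\<^sup>N - 1))\<close> is small away
  from the peak and has modulus \<open>1\<close> only where it equals \<open>1\<close>.
\<close>

lemma diagonal_of_exp_ranges: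
  fixes K :: "(complex \<times> complex) set"
  assumes K: "compact K"
    and ranges: "\<And>A B C M N. (\<lambda>y. fst y * exp (M * ((A + B * fst y + C * snd y) ^ N - 1))) ` K
      = (\<lambda>y. snd y * exp (M * ((A + B * fst y + C * snd y) ^ N - 1))) ` K"
    and y1: "y1 \<in> K"
  shows "fst y1 = snd y1"
proof (rule ccontr)
  assume ne: "fst y1 \<noteq> snd y1"
  define d where "d = snd y1 - fst y1"
  define n where "n = (- d, d)"
  have d: "cmod d > 0"
    using ne by (simp add: d_def)
  obtain R where R: "\<And>y. y \<in> K \<Longrightarrow> norm (y - y1) \<le> R"
    using compact_imp_bounded[OF K] unfolding bounded_any_center[of _ y1]
    by (auto simp: dist_norm norm_minus_commute)
  \<comment> \<open>Large enough that every diagonal point of \<open>K\<close> is closer to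
    \<open>c\<close> than \<open>y1\<close> is: the normal component of its offset from
    \<open>y1\<close> shortens the squared distance by \<open>2 * t * cmod d ^ 2\<close>, more than
    the at most \<open>R ^ 2\<close> that the offset adds.\<close>
  define t where "t = (R ^ 2 + 1) / (2 * cmod d ^ 2)"
  have t: "t > 0" "R ^ 2 < 2 * t * cmod d ^ 2"
    using d by (auto simp: t_def add_nonneg_pos)
  define c where "c = y1 - t *\<^sub>R n"
  obtain y0 where y0: "y0 \<in> K" "\<And>y. y \<in> K \<Longrightarrow> dist c y \<le> dist c y0"
    using distance_attains_sup[OF K, of c] y1 by blast
  define e where "e = y0 - c"
  have far: "norm (y - c) \<le> norm e" if "y \<in> K" for y
    using y0(2)[OF that] by (simp add: e_def dist_norm norm_minus_commute)
  have off: "fst y0 \<noteq> snd y0"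
  proof
    assume diag: "fst y0 = snd y0"
    have "y0 \<bullet> n = 0"
      using diag by (simp add: n_def inner_prod_def)
    moreover have "y1 \<bullet> n = cmod d ^ 2"
      by (simp add: n_def inner_prod_def d_def power2_norm_eq_inner inner_diff_left inner_diff_right inner_commute)
    ultimately have 1: "(y0 - y1) \<bullet> n = - (cmod d ^ 2)"
      by (simp add: inner_diff_left)
    have "norm (y1 - c) ^ 2 \<le> norm e ^ 2"
      using far[OF y1] by (intro power_mono) auto
    also have "norm e ^ 2 = norm ((y0 - y1) + t *\<^sub>R n) ^ 2"
      by (simp add: e_def c_def algebra_simps)
    also have "\<dots> = norm (y0 - y1) ^ 2 + 2 * t * ((y0 - y1) \<bullet> n) + norm (t *\<^sub>R n) ^ 2"
      by (simp only: power2_norm_eq_inner inner_add_left inner_add_right inner_scaleR_left inner_scaleR_right)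
         (simp add: inner_commute distrib_left)
    also have "norm (t *\<^sub>R n) = norm (y1 - c)"
      by (simp add: c_def)
    finally have "2 * t * cmod d ^ 2 \<le> norm (y0 - y1) ^ 2"
      by (simp add: 1)
    also have "\<dots> \<le> R ^ 2"
      using R[OF y0(1)] by (intro power_mono) auto
    finally show False
      using t by simp
  qed
  have e0: "norm e > 0"
  proof -
    have "norm (y1 - c) > 0"
      using t d by (auto simp: c_def n_def zero_prod_def)
    then show ?thesis
      using far[OF y1] by linarith
  qed
  \<comment> \<open>The Hermitian product with \<open>e\<close> is complex affine in the coordinates
    of \<open>y\<close>, as the admissible exponents demand, and its real part is the Euclidean
    inner product that exposes \<open>y0\<close>.\<close>
  define H where "H y = cnj (fst e) * fst (y - c) + cnj (snd e) * snd (y - c)" for y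
  define h where "h y = H y / of_real (norm e ^ 2)" for y
  have Re_H: "Re (H y) = e \<bullet> (y - c)" for y
    by (simp add: H_def inner_prod_def inner_complex_def)
  have H_le: "cmod (H y) \<le> norm e * norm (y - c)" for y
  proof -
    define a where "a = cmod (fst e)"
    define b where "b = cmod (snd e)"
    define a' where "a' = cmod (fst (y - c))"
    define b' where "b' = cmod (snd (y - c))"
    have "cmod (H y) \<le> a * a' + b * b'"
      unfolding H_def a_def b_def a'_def b'_def
      by (rule order.trans[OF norm_triangle_ineq]) (simp add: norm_mult)
    moreover have "(a * a' + b * b') ^ 2 \<le> (a ^ 2 + b ^ 2) * (a' ^ 2 + b' ^ 2)"
    proof -
      have "(a ^ 2 + b ^ 2) * (a' ^ 2 + b' ^ 2) - (a * a' + b * b') ^ 2 = (a * b' - b * a') ^ 2"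
        by (simp add: power2_eq_square algebra_simps)
      then show ?thesis
        using zero_le_power2[of "a * b' - b * a'"] by linarith
    qed
    then have "a * a' + b * b' \<le> sqrt ((a ^ 2 + b ^ 2) * (a' ^ 2 + b' ^ 2))"
      by (rule real_le_rsqrt)
    moreover have "sqrt ((a ^ 2 + b ^ 2) * (a' ^ 2 + b' ^ 2)) = norm e * norm (y - c)"
      by (simp add: norm_prod_def real_sqrt_mult a_def b_def a'_def b'_def)
    ultimately show ?thesis by simp
  qed
  have h1: "cmod (h y) \<le> 1" if "y \<in> K" for y
  proof -
    have "cmod (H y) \<le> norm e * norm e"
      using H_le[of y] far[OF that] by (meson mult_left_mono norm_ge_zero order.trans)
    then show ?thesis
      using e0 by (simp add: h_def norm_divide norm_mult power2_eq_square divide_simps)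
  qed
  have h_Re: "Re (h y) < 1" if "y \<in> K" "y \<noteq> y0" for y
  proof (rule ccontr)
    assume "\<not> ?thesis"
    then have "norm e ^ 2 \<le> e \<bullet> (y - c)"
      using e0 by (simp add: h_def Re_H[symmetric] Re_divide_of_real divide_simps)
    moreover have "norm (y - c) ^ 2 \<le> norm e ^ 2"
      using far[OF that(1)] by (intro power_mono) auto
    moreover have "norm (y - y0) ^ 2 = norm (y - c) ^ 2 - 2 * (e \<bullet> (y - c)) + norm e ^ 2"
    proof -
      have "y - y0 = (y - c) - e"
        by (simp add: e_def)
      then show ?thesis
        by (simp only: power2_norm_eq_inner inner_diff_left inner_diff_right) (simp add: inner_commute)
    qed
    ultimately have "norm (y - y0) ^ 2 \<le> 0"
      by linarith
    then show False
      using that by simp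
  qed
  \<comment> \<open>\<open>h\<close> may have modulus 1 at other points of \<open>K\<close>, but its
    real part is below 1 there; averaging with 1 turns this into a strict bound on the
    modulus.\<close>
  define p where "p y = (1 + h y) / 2" for y
  define i where "i = inverse (complex_of_real (norm e ^ 2)) * inverse 2"
  define B where "B = cnj (fst e) * i"
  define C where "C = cnj (snd e) * i"
  define A where "A = inverse 2 - B * fst c - C * snd c"
  have p_eq: "p y = A + B * fst y + C * snd y" for y
  proof -
    have "p y = inverse 2 + H y * i"
      by (simp only: p_def h_def i_def divide_inverse distrib_right mult_1 mult.assoc)
    then show ?thesis
      by (simp add: H_def A_def B_def C_def algebra_simps)
  qed
  have p_cont: "continuous_on K p"
    unfolding p_eq by (intro continuous_intros)
  have p0: "p y0 = 1"
  proof -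
    have "H y0 = of_real (norm e ^ 2)"
      using complex_norm_square[of "fst e"] complex_norm_square[of "snd e"]
      by (simp add: H_def norm_prod_def mult.commute flip: e_def)
    then show ?thesis
      using e0 by (simp add: p_def h_def)
  qed
  have p_lt: "cmod (p y) < 1" if "y \<in> K" "y \<noteq> y0" for y
  proof -
    have "cmod (1 + h y) ^ 2 = 1 + 2 * Re (h y) + cmod (h y) ^ 2"
      unfolding cmod_power2 by (simp add: power2_eq_square algebra_simps)
    also have "\<dots> < 1 + 2 * 1 + 1"
      using h_Re[OF that] power_mono[OF h1[OF that(1)], of 2] by simp
    finally have "cmod (1 + h y) ^ 2 < 2 ^ 2"
      by simp
    then have "cmod (1 + h y) < 2"
      by (rule power_less_imp_less_base) simp
    then show ?thesis
      by (simp add: p_def norm_divide)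
  qed
  have swap: "\<exists>y\<in>K. fst y * exp (M * (p y ^ N - 1)) = snd y0"
    "\<exists>y\<in>K. snd y * exp (M * (p y ^ N - 1)) = fst y0" for M N
  proof -
    have r: "(\<lambda>y. fst y * exp (M * (p y ^ N - 1))) ` K = (\<lambda>y. snd y * exp (M * (p y ^ N - 1))) ` K"
      using ranges by (simp only: p_eq)
    have "fst y0 * exp (M * (p y0 ^ N - 1)) = fst y0" "snd y0 * exp (M * (p y0 ^ N - 1)) = snd y0"
      by (simp_all add: p0)
    then have "fst y0 \<in> (\<lambda>y. fst y * exp (M * (p y ^ N - 1))) ` K"
      "snd y0 \<in> (\<lambda>y. snd y * exp (M * (p y ^ N - 1))) ` K"
      using y0(1) by (metis (no_types, lifting) image_eqI)+
    then have "fst y0 \<in> (\<lambda>y. snd y * exp (M * (p y ^ N - 1))) ` K"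
      "snd y0 \<in> (\<lambda>y. fst y * exp (M * (p y ^ N - 1))) ` K"
      using r by simp_all
    then show "\<exists>y\<in>K. fst y * exp (M * (p y ^ N - 1)) = snd y0"
      "\<exists>y\<in>K. snd y * exp (M * (p y ^ N - 1)) = fst y0"
      by (metis (no_types, lifting) imageE)+
  qed
  \<comment> \<open>At the peak the factor is 1, so each coordinate of \<open>y0\<close> is attained
    in the other range. The peak lemma needs a target at least as large as the peak value, which
    decides which coordinate is the target.\<close>
  show False
  proof (cases "cmod (fst y0) \<le> cmod (snd y0)")
    case True
    have "snd y0 = fst y0"
      by (rule peak_value_attained[OF K y0(1) _ p_cont p0 p_lt True swap(1)])
        (auto intro: continuous_intros)
    then show False
      using off by simp
  next
    case False
    then have "fst y0 = snd y0"
      by (intro peak_value_attained[OF K y0(1) _ p_cont p0 p_lt _ swap(2)])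
        (auto intro: continuous_intros)
    then show False
      using off by simp
  qed
qed

text \<open>Recovers \<open>w\<close> from \<open>exp (w / n)\<close> with an error uniform for
  \<open>w\<close> in a disc. It replaces logarithms of elements that are known only through
  exponentials.\<close>

lemma exp_difference_quotient:
  assumes "cmod w \<le> R" "n > 0"
  shows "cmod (of_nat n * (exp (w / of_nat n) - 1) - w) \<le> exp R * R ^ 2 / real n"
proof -
  define z where "z = w / of_nat n"
  have w: "w = of_nat n * z"
    using assms by (simp add: z_def)
  have z: "cmod z \<le> R / real n"
    using assms by (simp add: z_def norm_divide divide_right_mono)
  have R: "0 \<le> R"
    using assms norm_ge_zero order.trans by blast
  have zR: "cmod z \<le> R"
  proof -
    have "R * 1 \<le> R * real n"
      using R assms by (intro mult_left_mono) auto
    then have "R / real n \<le> R"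
      using assms by (simp add: divide_simps)
    then show ?thesis
      using z by linarith
  qed
  have "cmod (exp z - (1 + z)) \<le> exp (cmod z) * cmod z ^ 2"
    using Taylor_exp_field[of z 1] by (simp add: power2_eq_square)
  also have "\<dots> \<le> exp R * (R / real n) ^ 2"
    using zR z by (intro mult_mono power_mono) auto
  finally have *: "cmod (exp z - 1 - z) \<le> exp R * (R / real n) ^ 2"
    by (simp add: algebra_simps)
  have "of_nat n * (exp z - 1) - w = of_nat n * (exp z - 1 - z)"
    by (simp add: w algebra_simps)
  then have "cmod (of_nat n * (exp z - 1) - w) = real n * cmod (exp z - 1 - z)"
    by (simp add: norm_mult)
  also have "\<dots> \<le> real n * (exp R * (R / real n) ^ 2)"
    using * by (intro mult_left_mono) auto
  also have "\<dots> = exp R * R ^ 2 / real n"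
    using assms by (simp add: power2_eq_square)
  finally show ?thesis
    by (simp add: z_def)
qed

section \<open>Maps preserving the spectra of products\<close>

text \<open>The range identities are available only with an approximation \<open>b'\<close> of
  \<open>b\<close> inside the exponent. The third slot of \<open>k1\<close> and \<open>k2\<close>
  holds it and merges with the second in the limit. Convergence along arbitrary sequences of indices
  encodes uniformity, which matters because the matching index \<open>j\<close> changes with
  \<open>n\<close>.\<close>

lemma exp_ranges_closure:
  fixes I :: "'i set" and a b :: "'i \<Rightarrow> complex" and b' :: "nat \<Rightarrow> 'i \<Rightarrow> complex"
    and k1 k2 :: "complex \<times> complex \<times> complex \<Rightarrow> complex"
  defines "K \<equiv> closure ((\<lambda>i. (a i, b i)) ` I)"
  assumes K: "compact K"
    and cont: "continuous_on UNIV k1" "continuous_on UNIV k2"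
    and lim: "\<And>s. (\<And>n. s n \<in> I) \<Longrightarrow> (\<lambda>n. b' n (s n) - b (s n)) \<longlonglongrightarrow> 0"
    and eq: "\<And>n i. i \<in> I \<Longrightarrow> \<exists>j\<in>I. k1 (a i, b i, b' n i) = k2 (a j, b j, b' n j)"
  shows "(\<lambda>y. k1 (fst y, snd y, snd y)) ` K \<subseteq> (\<lambda>y. k2 (fst y, snd y, snd y)) ` K"
proof -
  define m1 where "m1 y = k1 (fst y, snd y, snd y)" for y
  define m2 where "m2 y = k2 (fst y, snd y, snd y)" for y
  have m_cont: "continuous_on S m1" "continuous_on S m2" for S
    unfolding m1_def m2_def
    by (rule continuous_on_compose2[OF cont(1)] continuous_on_compose2[OF cont(2)],
        (intro continuous_intros subset_UNIV)+)+
  have k_lim: "(\<lambda>n. k (x n)) \<longlonglongrightarrow> k l" if "continuous_on UNIV k" "x \<longlonglongrightarrow> l"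
    for k :: "complex \<times> complex \<times> complex \<Rightarrow> complex" and x l
    using continuous_on_tendsto_compose[OF that] by simp
  have point: "m1 (a i, b i) \<in> m2 ` K" if i: "i \<in> I" for i
  proof -
    obtain s where s: "\<And>n. s n \<in> I" "\<And>n. k1 (a i, b i, b' n i) = k2 (a (s n), b (s n), b' n (s n))"
      using eq[OF i] by metis
    have "\<forall>n. (a (s n), b (s n)) \<in> K"
      using s(1) closure_subset[of "(\<lambda>i. (a i, b i)) ` I"] by (auto simp: K_def)
    with compact_imp_seq_compact[OF K] obtain l r where l: "l \<in> K" "strict_mono (r :: nat \<Rightarrow> nat)"
      "((\<lambda>n. (a (s n), b (s n))) \<circ> r) \<longlonglongrightarrow> l"
      by (rule seq_compactE)
    have la: "(\<lambda>n. a (s (r n))) \<longlonglongrightarrow> fst l" and lb: "(\<lambda>n. b (s (r n))) \<longlonglongrightarrow> snd l"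
      using tendsto_fst[OF l(3)] tendsto_snd[OF l(3)] by (simp_all add: o_def)
    have "(\<lambda>n. b' (r n) (s (r n)) - b (s (r n))) \<longlonglongrightarrow> 0"
      using LIMSEQ_subseq_LIMSEQ[OF lim[OF s(1)] l(2)] by (simp add: o_def)
    from tendsto_add[OF this lb] have lb': "(\<lambda>n. b' (r n) (s (r n))) \<longlonglongrightarrow> snd l"
      by simp
    have "(\<lambda>n. k2 (a (s (r n)), b (s (r n)), b' (r n) (s (r n)))) \<longlonglongrightarrow> k2 (fst l, snd l, snd l)"
      by (intro k_lim cont tendsto_Pair la lb lb')
    moreover have "(\<lambda>n. k1 (a i, b i, b' (r n) i)) \<longlonglongrightarrow> k1 (a i, b i, b i)"
    proof -
      have "(\<lambda>n. b' n i - b i) \<longlonglongrightarrow> 0"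
        using lim[of "\<lambda>_. i"] i by simp
      from tendsto_add[OF this tendsto_const[of "b i"]] have "(\<lambda>n. b' n i) \<longlonglongrightarrow> b i"
        by simp
      then have "(\<lambda>n. b' (r n) i) \<longlonglongrightarrow> b i"
        using LIMSEQ_subseq_LIMSEQ[OF _ l(2)] by (auto simp: o_def)
      then show ?thesis
        by (intro k_lim cont tendsto_Pair tendsto_const)
    qed
    ultimately have "k1 (a i, b i, b i) = k2 (fst l, snd l, snd l)"
      unfolding s(2) using LIMSEQ_unique by blast
    then show ?thesis
      using l(1) by (auto simp: m1_def m2_def)
  qed
  have "m1 ` K \<subseteq> m2 ` K"
    unfolding K_def
  proof (rule image_closure_subset)
    show "continuous_on (closure ((\<lambda>i. (a i, b i)) ` I)) m1"
      by (rule m_cont)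
    show "closed (m2 ` closure ((\<lambda>i. (a i, b i)) ` I))"
      using compact_continuous_image[OF m_cont(2) K] by (simp add: K_def compact_imp_closed)
    show "m1 ` (\<lambda>i. (a i, b i)) ` I \<subseteq> m2 ` closure ((\<lambda>i. (a i, b i)) ` I)"
      using point by (auto simp: K_def)
  qed
  then show ?thesis
    by (simp add: m1_def m2_def)
qed

text \<open>After real scaling into the unit ball, imaginary parts stay below pi and
  \<open>Ln\<close> recovers the characters.\<close>

lemma character_eq_if_exp_eq:
  fixes \<theta> \<theta>' :: "'a::complex_comm_banach_algebra_1 \<Rightarrow> complex"
  assumes \<theta>: "\<theta> \<in> characters" "\<theta>' \<in> characters" and eq: "\<And>f. exp (\<theta>' f) = exp (\<theta> f)"
  shows "\<theta>' = \<theta>"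
proof
  fix f :: 'a
  define t where "t = 1 / (norm f + 1)"
  have n: "norm f + 1 > 0"
    using norm_ge_zero[of f] by linarith
  then have t: "t > 0"
    by (simp add: t_def)
  have "norm (t *\<^sub>R f) \<le> 1"
    using n by (simp add: t_def divide_simps)
  then have "\<bar>Im (\<theta> (t *\<^sub>R f))\<bar> \<le> 1" "\<bar>Im (\<theta>' (t *\<^sub>R f))\<bar> \<le> 1"
    using abs_Im_le_cmod[of "\<theta> (t *\<^sub>R f)"] abs_Im_le_cmod[of "\<theta>' (t *\<^sub>R f)"]
      char_bound[OF \<theta>(1), of "t *\<^sub>R f"] char_bound[OF \<theta>(2), of "t *\<^sub>R f"]
    by linarith+
  then have "Ln (exp (\<theta> (t *\<^sub>R f))) = \<theta> (t *\<^sub>R f)" "Ln (exp (\<theta>' (t *\<^sub>R f))) = \<theta>' (t *\<^sub>R f)"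
    using pi_gt3 by (auto intro!: Ln_exp)
  then have "\<theta>' (t *\<^sub>R f) = \<theta> (t *\<^sub>R f)"
    using eq by metis
  then show "\<theta>' f = \<theta> f"
    using t by (simp add: char_scaleR \<theta>)
qed

lemma ratio_iso_character:
  fixes V :: "'a::complex_comm_banach_algebra_1 \<Rightarrow> 'b::complex_comm_banach_algebra_1"
  assumes "semisimple TYPE('a)" "ratio_iso V" "V 1 = 1" "\<phi> \<in> characters"
  shows "\<exists>\<theta>\<in>characters. \<forall>f. \<phi> (V (aexp f)) = exp (\<theta> f)"
proof -
  obtain L where L: "\<And>f g. L (f + g) = L f + L g" "\<And>f. L f \<in> spectrum f"
    "\<And>f. \<phi> (V (aexp f)) = exp (L f)"
    by (rule ratio_iso_log[OF assms]) blast
  have "L \<in> characters"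
    by (rule additive_spectral_character[OF L(1,2)])
  then show ?thesis
    using L(3) by blast
qed

text \<open>\<open>V (aexp f)\<close> is not known to be an exponential, so \<open>h n\<close>
  serves as its approximate logarithm: at each character of the range, \<open>h n\<close> is within
  \<open>e n\<close> of the value at \<open>f\<close> of the associated character. Then
  \<open>W (aexp (h n))\<close> approaches \<open>W (V (aexp f)) = aexp f\<close> in ratio, while
  its value at \<theta> tends to \<open>exp (\<theta>' f)\<close>.\<close>

lemma ratio_iso_character_inverse:
  fixes V :: "'a::complex_comm_banach_algebra_1 \<Rightarrow> 'b::complex_comm_banach_algebra_1"
    and W :: "'b \<Rightarrow> 'a"
  assumes W: "ratio_iso W" "\<And>x. x dvd 1 \<Longrightarrow> W (V x) = x" "\<And>x. x dvd 1 \<Longrightarrow> V x dvd 1"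
    and V: "\<And>\<phi>. \<phi> \<in> characters \<Longrightarrow> \<exists>\<theta>\<in>characters. \<forall>f. \<phi> (V (aexp f)) = exp (\<theta> f)"
    and \<theta>: "\<theta> \<in> characters" and \<phi>: "\<phi> \<in> characters" "\<And>h. \<theta> (W (aexp h)) = exp (\<phi> h)"
    and \<theta>': "\<theta>' \<in> characters" "\<And>f. \<phi> (V (aexp f)) = exp (\<theta>' f)"
  shows "\<theta>' = \<theta>"
proof (rule character_eq_if_exp_eq[OF \<theta> \<theta>'(1)])
  fix f :: 'a
  define h where "h n = cc (of_nat (Suc n)) * (V (aexp (cc (1 / of_nat (Suc n)) * f)) - 1)" for n
  define R where "R = norm f"
  define e where "e n = exp R * R ^ 2 / real (Suc n)" for n
  have e: "e \<longlonglongrightarrow> 0"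
    unfolding e_def by (rule LIMSEQ_Suc, rule lim_const_over_n)
  have h: "cmod (\<phi>1 (h n) - \<theta>1 f) \<le> e n"
    if "\<phi>1 \<in> characters" "\<theta>1 \<in> characters" "\<And>f. \<phi>1 (V (aexp f)) = exp (\<theta>1 f)" for \<phi>1 \<theta>1 n
  proof -
    have "\<phi>1 (h n) = of_nat (Suc n) * (exp (\<theta>1 f / of_nat (Suc n)) - 1)"
      by (simp add: h_def char_mult[OF that(1)] char_cc[OF that(1)] char_diff[OF that(1)] char_1[OF that(1)] that(3)
          char_mult[OF that(2)] char_cc[OF that(2)] del: of_nat_Suc)
    then show ?thesis
      unfolding e_def
      using exp_difference_quotient[of "\<theta>1 f" R "Suc n"] char_bound[OF that(2), of f] by (simp add: R_def)
  qed
  have "(\<lambda>n. \<phi> (h n) - \<theta>' f) \<longlonglongrightarrow> 0"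
    by (rule Lim_null_comparison[OF _ e]) (use h[OF \<phi>(1) \<theta>'] in auto)
  then have "(\<lambda>n. \<phi> (h n)) \<longlonglongrightarrow> \<theta>' f"
    by (rule LIM_zero_cancel)
  then have 1: "(\<lambda>n. \<theta> (W (aexp (h n)))) \<longlonglongrightarrow> exp (\<theta>' f)"
    unfolding \<phi>(2) by (rule tendsto_exp)
  \<comment> \<open>Equality of ratio sets yields a character \<open>\<phi>1\<close> that varies
    with \<open>n\<close>; the uniform error bound covers this.\<close>
  have "\<exists>z. \<theta> (W (aexp (h n))) = \<theta> (aexp f) * exp z \<and> cmod z \<le> e n" for n
  proof -
    have "\<theta> (W (aexp (h n))) / \<theta> (aexp f) \<in> ratios (W (aexp (h n))) (W (V (aexp f)))"
      using \<theta> W(2)[OF aexp_unit, of f] by (auto simp: ratios_def)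
    also have "\<dots> = ratios (aexp (h n)) (V (aexp f))"
      by (intro ratio_iso_ratios W aexp_unit)
    finally obtain \<phi>1 where \<phi>1: "\<phi>1 \<in> characters"
      "\<theta> (W (aexp (h n))) / \<theta> (aexp f) = exp (\<phi>1 (h n)) / \<phi>1 (V (aexp f))"
      by (auto simp: ratios_def char_aexp)
    obtain \<theta>1 where \<theta>1: "\<theta>1 \<in> characters" "\<And>f. \<phi>1 (V (aexp f)) = exp (\<theta>1 f)"
      using V[OF \<phi>1(1)] by blast
    have "\<theta> (W (aexp (h n))) = \<theta> (aexp f) * exp (\<phi>1 (h n) - \<theta>1 f)"
      using \<phi>1(2) char_unit[OF \<theta> aexp_unit, of f] by (simp add: \<theta>1 exp_diff field_simps)
    then show ?thesis
      using h[OF \<phi>1(1) \<theta>1] by blast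
  qed
  then obtain z where z: "\<And>n. \<theta> (W (aexp (h n))) = \<theta> (aexp f) * exp (z n)" "\<And>n. cmod (z n) \<le> e n"
    by metis
  have "z \<longlonglongrightarrow> 0"
    by (rule Lim_null_comparison[OF _ e]) (use z(2) in auto)
  then have "(\<lambda>n. \<theta> (W (aexp (h n)))) \<longlonglongrightarrow> \<theta> (aexp f) * exp 0"
    unfolding z(1) by (intro tendsto_intros)
  then show "exp (\<theta>' f) = exp (\<theta> f)"
    using LIMSEQ_unique[OF 1] by (simp add: char_aexp[OF \<theta>])
qed

lemma spectrum_1_char: "spectrum x = {1} \<Longrightarrow> \<phi> \<in> characters \<Longrightarrow> \<phi> x = 1"
  by (metis char_in_spectrum singletonD)

lemma spectrum_one: "spectrum (1::'a::complex_comm_banach_algebra_1) = {1}"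
  unfolding spectrum_eq using characters_nonempty[where 'a='a]
  by (auto simp: char_1 image_iff)

text \<open>Two maps are needed because shifting \<open>T\<close> by \<open>b\<close> and by
  \<open>a\<close> gives different ones. The last conclusion ties \<open>S2\<close> to
  \<open>S1\<close> on units; it is what later determines \<open>S1 1\<close>.\<close>

theorem product_spectrum_preserver:
  fixes S1 S2 :: "'a::complex_comm_banach_algebra_1 \<Rightarrow> 'b::complex_comm_banach_algebra_1"
  assumes ss: "semisimple TYPE('a)" and surj: "surj S1" "surj S2"
    and spec: "\<And>F G. spectrum (S1 F * S2 G) = spectrum (F * G)"
  obtains U where "semisimple TYPE('b)" "algebra_isomorphism U" "\<And>F. S1 F = S1 1 * U F"
    "\<And>x. x dvd 1 \<Longrightarrow> S1 x * S2 (uinv x) = 1"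
proof -
  have sepA: "x = y" if "\<And>\<theta>. \<theta> \<in> characters \<Longrightarrow> \<theta> x = \<theta> y" for x y :: 'a
    using ss that by (auto simp: semisimple_iff_separating)
  have char_S: "\<phi> (S1 x * S2 (uinv x)) = 1" if "x dvd 1" "\<phi> \<in> characters" for x \<phi>
    using spec[of x "uinv x"] that by (intro spectrum_1_char) (simp_all add: mult_uinv spectrum_one)
  have S1_unit: "S1 x dvd 1" if "x dvd 1" for x
  proof -
    have "\<phi> (S1 x) \<noteq> 0" if "\<phi> \<in> characters" for \<phi>
      using char_S[OF \<open>x dvd 1\<close> that] by (auto simp: char_mult[OF that])
    then show ?thesis
      by (simp add: unit_iff_char)
  qed
  have S1_unit_conv: "x dvd 1" if "S1 x dvd 1" for x
  proof -
    obtain G where "S2 G = uinv (S1 x)"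
      using surj(2) by (metis surjD)
    then have *: "spectrum (x * G) = {1}"
      using spec[of x G] that by (simp add: mult_uinv spectrum_one)
    have "\<theta> x \<noteq> 0" if "\<theta> \<in> characters" for \<theta>
      using spectrum_1_char[OF * that] by (auto simp: char_mult[OF that])
    then show ?thesis
      by (simp add: unit_iff_char)
  qed
  \<comment> \<open>Testing with the inverse requires \<open>x\<close> to be a unit, while
    \<open>x'\<close> is arbitrary.\<close>
  have inj: "x = x'" if "x dvd 1" "\<And>G. spectrum (x * G) = spectrum (x' * G)" for x x' :: 'a
  proof (rule sepA)
    fix \<theta> :: "'a \<Rightarrow> complex" assume \<theta>: "\<theta> \<in> characters"
    have "spectrum (x' * uinv x) = {1}"
      using that(2)[of "uinv x"] that(1) by (simp add: mult_uinv spectrum_one)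
    then have "\<theta> (x' * uinv x) = 1"
      using \<theta> by (rule spectrum_1_char)
    then show "\<theta> x = \<theta> x'"
      using char_unit[OF \<theta> that(1)] by (simp add: char_mult[OF \<theta>] char_uinv[OF \<theta> that(1)] divide_simps)
  qed
  \<comment> \<open>A difference \<open>d\<close> that all characters annihilate is added to 1:
    preimages of 1 and of 1 + d have products with equal spectra, and the preimage of 1 is a unit,
    so \<open>inj\<close> applies and \<open>d = 0\<close>.\<close>
  have sepB: "y = y'" if eq: "\<And>\<phi>. \<phi> \<in> characters \<Longrightarrow> \<phi> y = \<phi> y'" for y y' :: 'b
  proof -
    define d where "d = y - y'"
    obtain x x' where x: "S1 x = 1" "S1 x' = 1 + d"
      using surj(1) by (metis surjD)
    have "spectrum (x * G) = spectrum (x' * G)" for G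
    proof -
      have "spectrum (S1 x * S2 G) = spectrum (S1 x' * S2 G)"
        unfolding spectrum_eq x by (intro image_cong refl) (simp add: char_simps d_def eq)
      then show ?thesis
        by (simp add: spec)
    qed
    then have "x = x'"
      by (rule inj[rotated]) (simp add: S1_unit_conv x)
    then show ?thesis
      using x by (simp add: d_def)
  qed
  then have ssB: "semisimple TYPE('b)"
    by (simp add: semisimple_iff_separating)
  have S12: "S1 x * S2 (uinv x) = 1" if "x dvd 1" for x
    using char_S[OF that] by (intro sepB) (simp add: char_1)
  define k where "k = S1 1"
  have k: "k dvd 1"
    by (simp add: k_def S1_unit)
  define U where "U F = uinv k * S1 F" for F
  have kU: "k * U F = S1 F" for F
    by (simp only: U_def mult.assoc[symmetric] mult_uinv[OF k] mult_1_left)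
  have char_kU: "\<phi> (S1 F) = \<phi> k * \<phi> (U F)" if "\<phi> \<in> characters" for \<phi> F
    using kU char_mult[OF that] by metis
  have surjU: "\<exists>F. U F = y" for y
  proof -
    obtain F where "S1 F = k * y"
      using surj(1) by (metis surjD)
    then have "U F = y"
      by (simp only: U_def mult.assoc[symmetric] mult.commute[of "uinv k" k] mult_uinv[OF k] mult_1_left)
    then show ?thesis by blast
  qed
  have "bij_betw U {x. x dvd 1} {y. y dvd 1}"
  proof (rule bij_betw_imageI)
    show "inj_on U {x. x dvd 1}"
    proof (rule inj_onI)
      fix x x' assume x: "x \<in> {x. x dvd 1}" "U x = U x'"
      then have "S1 x = S1 x'"
        by (metis kU)
      then have "spectrum (x * G) = spectrum (x' * G)" for G
        using spec[of x G] spec[of x' G] by simp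
      then show "x = x'"
        using x by (intro inj) simp_all
    qed
    show "U ` {x. x dvd 1} = {y. y dvd 1}"
    proof (intro equalityI subsetI)
      fix y assume "y \<in> U ` {x. x dvd 1}"
      then show "y \<in> {y. y dvd 1}"
        using k by (auto simp: U_def intro!: unit_mult uinv_unit S1_unit)
    next
      fix y :: 'b assume y: "y \<in> {y. y dvd 1}"
      obtain x where x: "U x = y"
        using surjU by blast
      then have "S1 x dvd 1"
        using y k kU[of x] unit_mult[of k y] by simp
      then show "y \<in> U ` {x. x dvd 1}"
        using x S1_unit_conv by blast
    qed
  qed
  moreover have "ratios (U x) (U y) = ratios x y" if u: "x dvd 1" "y dvd 1" for x y
  proof -
    have "ratios (U x) (U y) = (\<lambda>\<phi>. \<phi> (S1 x * S2 (uinv y))) ` characters"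
      unfolding ratios_def
    proof (intro image_cong refl)
      fix \<phi> :: "'b \<Rightarrow> complex" assume \<phi>: "\<phi> \<in> characters"
      have nz: "\<phi> k \<noteq> 0" "\<phi> (S1 y) \<noteq> 0"
        using \<phi> k u by (simp_all add: char_unit S1_unit)
      have "\<phi> (S1 y) * \<phi> (S2 (uinv y)) = 1"
        using char_S[OF u(2) \<phi>] by (simp add: char_mult[OF \<phi>])
      then have "\<phi> (S2 (uinv y)) = 1 / \<phi> (S1 y)"
        using nz by (simp add: divide_simps mult.commute)
      then show "\<phi> (U x) / \<phi> (U y) = \<phi> (S1 x * S2 (uinv y))"
        using nz by (simp add: char_mult[OF \<phi>] char_kU[OF \<phi>])
    qed
    also have "\<dots> = spectrum (x * uinv y)"
      using spec[of x "uinv y"] by (simp add: spectrum_eq)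
    also have "\<dots> = ratios x y"
      unfolding ratios_def spectrum_eq
      using u by (intro image_cong refl) (simp add: char_mult char_uinv divide_inverse)
    finally show ?thesis .
  qed
  ultimately have U: "ratio_iso U"
    by (simp add: ratio_iso_def)
  have U1: "U 1 = 1"
    using mult_uinv[OF k] by (simp add: U_def k_def mult.commute)
  define W where "W = ratio_inv U"
  have W: "ratio_iso W"
    unfolding W_def by (rule ratio_iso_inv[OF U])
  have WU: "W (U x) = x" if "x dvd 1" for x
    using that U by (simp add: W_def ratio_inv_left)
  have UW: "U (W y) = y" if "y dvd 1" for y
    using that U by (simp add: W_def ratio_inv_right)
  have W1: "W 1 = 1"
    using WU[of 1] U1 by simp
  have exU: "\<exists>\<theta>\<in>characters. \<forall>f. \<phi> (U (aexp f)) = exp (\<theta> f)" if "\<phi> \<in> characters" for \<phi>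
    using ratio_iso_character[OF ss U U1 that] .
  have exW: "\<exists>\<phi>\<in>characters. \<forall>h. \<theta> (W (aexp h)) = exp (\<phi> h)" if "\<theta> \<in> characters" for \<theta>
    using ratio_iso_character[OF ssB W W1 that] .
  obtain \<Phi> where \<Phi>: "\<And>\<phi>. \<phi> \<in> characters \<Longrightarrow> \<Phi> \<phi> \<in> characters"
    "\<And>\<phi> f. \<phi> \<in> characters \<Longrightarrow> \<phi> (U (aexp f)) = exp (\<Phi> \<phi> f)"
    using exU by metis
  \<comment> \<open>Evaluates \<open>\<Phi> \<phi>\<close> on elements pulled back from B, as the
    approximants \<open>bA\<close> below require.\<close>
  have \<Phi>_W: "\<Phi> \<phi> (W (aexp h)) = exp (\<phi> h)" if \<phi>: "\<phi> \<in> characters" for \<phi> h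
  proof -
    obtain \<phi>' where \<phi>': "\<phi>' \<in> characters" "\<And>h. \<Phi> \<phi> (W (aexp h)) = exp (\<phi>' h)"
      using exW[OF \<Phi>(1)[OF \<phi>]] by blast
    have "\<phi>' = \<phi>"
      using ratio_iso_character_inverse[of U W \<phi> "\<Phi> \<phi>" \<phi>', OF U UW ratio_iso_unit[OF W] exW \<phi> \<Phi>(1)[OF \<phi>] \<Phi>(2)[OF \<phi>] \<phi>']
      by simp
    then show ?thesis
      using \<phi>' by simp
  qed
  have \<Phi>_onto: "\<exists>\<phi>\<in>characters. \<Phi> \<phi> = \<theta>" if \<theta>: "\<theta> \<in> characters" for \<theta>
  proof -
    obtain \<phi> where \<phi>: "\<phi> \<in> characters" "\<And>h. \<theta> (W (aexp h)) = exp (\<phi> h)"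
      using exW[OF \<theta>] by blast
    have "\<Phi> \<phi> = \<theta>"
      using ratio_iso_character_inverse[of W U \<theta> \<phi> "\<Phi> \<phi>", OF W WU ratio_iso_unit[OF U] exU \<theta> \<phi> \<Phi>(1)[OF \<phi>(1)] \<Phi>(2)[OF \<phi>(1)]]
      by simp
    then show ?thesis
      using \<phi> by blast
  qed
  \<comment> \<open>\<open>S2 (aexp f)\<close> inverts \<open>S1 (aexp (- f))\<close>, where
    \<open>U\<close> is already understood; \<open>F\<close> may be any element. The factor
    \<open>S1 1\<close> cancels.\<close>
  have range_exp: "(\<lambda>\<phi>. \<phi> (U F) * exp (\<Phi> \<phi> f)) ` characters = (\<lambda>\<phi>. \<Phi> \<phi> F * exp (\<Phi> \<phi> f)) ` characters" for F f
  proof -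
    have "uinv (aexp (- f)) = aexp f"
      by (rule sepA) (simp add: char_uinv aexp_unit char_aexp char_minus exp_minus)
    then have "S1 (aexp (- f)) * S2 (aexp f) = 1"
      using S12[OF aexp_unit, of "- f"] by simp
    then have S2: "\<phi> (S1 (aexp (- f))) * \<phi> (S2 (aexp f)) = 1" if "\<phi> \<in> characters" for \<phi>
      using char_mult[OF that] char_1[OF that] by metis
    have "(\<lambda>\<phi>. \<phi> (U F) * exp (\<Phi> \<phi> f)) ` characters = (\<lambda>\<phi>. \<phi> (S1 F * S2 (aexp f))) ` characters"
    proof (intro image_cong refl)
      fix \<phi> :: "'b \<Rightarrow> complex" assume \<phi>: "\<phi> \<in> characters"
      have nz: "\<phi> k \<noteq> 0"
        using \<phi> k by (simp add: char_unit)
      have "\<phi> k * exp (- \<Phi> \<phi> f) * \<phi> (S2 (aexp f)) = 1"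
        using S2[OF \<phi>] by (simp add: char_kU[OF \<phi>] \<Phi>(2)[OF \<phi>] char_minus[OF \<Phi>(1)[OF \<phi>]])
      then have "\<phi> (S2 (aexp f)) = exp (\<Phi> \<phi> f) / \<phi> k"
        using nz by (simp add: exp_minus divide_simps mult_ac)
      then show "\<phi> (U F) * exp (\<Phi> \<phi> f) = \<phi> (S1 F * S2 (aexp f))"
        using nz by (simp add: char_mult[OF \<phi>] char_kU[OF \<phi>])
    qed
    also have "\<dots> = spectrum (F * aexp f)"
      using spec[of F "aexp f"] by (simp add: spectrum_eq)
    also have "\<dots> = (\<lambda>\<theta>. \<theta> F * exp (\<theta> f)) ` characters"
      unfolding spectrum_eq by (intro image_cong refl) (simp add: char_mult char_aexp)
    also have "\<dots> = (\<lambda>\<theta>. \<theta> F * exp (\<theta> f)) ` \<Phi> ` characters"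
    proof -
      have "\<Phi> ` characters = characters"
        using \<Phi>(1) \<Phi>_onto by blast
      then show ?thesis by simp
    qed
    finally show ?thesis
      by (simp add: image_image)
  qed
  have U_char: "\<phi>0 (U F) = \<Phi> \<phi>0 F" if \<phi>0: "\<phi>0 \<in> characters" for \<phi>0 F
  proof -
    define a where "a \<phi> = \<Phi> \<phi> F" for \<phi>
    define b where "b \<phi> = \<phi> (U F)" for \<phi> :: "'b \<Rightarrow> complex"
    define h where "h = U F"
    \<comment> \<open>An approximate preimage of \<open>U F\<close> in A: by \<open>\<Phi>_W\<close>
      its value at \<open>\<Phi> \<phi>\<close> is the difference quotient that tends to
      \<open>\<phi> (U F)\<close> uniformly.\<close>
    define bA where "bA n = cc (of_nat (Suc n)) * (W (aexp (cc (1 / of_nat (Suc n)) * h)) - 1)" for n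
    define b' where "b' n \<phi> = \<Phi> \<phi> (bA n)" for n \<phi>
    define K where "K = closure ((\<lambda>\<phi>. (a \<phi>, b \<phi>)) ` characters)"
    have "bounded ((\<lambda>\<phi>. (a \<phi>, b \<phi>)) ` characters)"
    proof -
      have "a ` characters \<subseteq> cball 0 (norm F)" "b ` characters \<subseteq> cball 0 (norm h)"
        using char_bound[OF \<Phi>(1)] char_bound by (auto simp: a_def b_def h_def)
      then have "(\<lambda>\<phi>. (a \<phi>, b \<phi>)) ` characters \<subseteq> cball 0 (norm F) \<times> cball 0 (norm h)"
        by blast
      then show ?thesis
        by (rule bounded_subset[rotated]) (intro bounded_Times bounded_cball)
    qed
    then have K: "compact K"
      by (simp add: K_def compact_closure)
    have b'_val: "cmod (b' n \<phi> - b \<phi>) \<le> exp (norm h) * norm h ^ 2 / real (Suc n)"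
      if \<phi>: "\<phi> \<in> characters" for n \<phi>
    proof -
      have "b' n \<phi> = of_nat (Suc n) * (exp (\<phi> h / of_nat (Suc n)) - 1)"
        using \<Phi>(1)[OF \<phi>] \<phi>
        by (simp add: b'_def bA_def char_mult char_cc char_diff char_1 \<Phi>_W del: of_nat_Suc)
      then show ?thesis
        unfolding b_def h_def[symmetric]
        using exp_difference_quotient[OF char_bound[OF \<phi>], of "Suc n" h] by simp
    qed
    have lim: "(\<lambda>n. b' n (s n) - b (s n)) \<longlonglongrightarrow> 0" if "\<And>n. s n \<in> characters" for s
    proof (rule Lim_null_comparison)
      show "\<forall>\<^sub>F n in sequentially. cmod (b' n (s n) - b (s n)) \<le> exp (norm h) * norm h ^ 2 / real (Suc n)"
        using b'_val that by auto
      show "(\<lambda>n. exp (norm h) * norm h ^ 2 / real (Suc n)) \<longlonglongrightarrow> 0"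
        by (rule LIMSEQ_Suc, rule lim_const_over_n)
    qed
    have "fst (a \<phi>0, b \<phi>0) = snd (a \<phi>0, b \<phi>0)"
    proof (rule diagonal_of_exp_ranges[OF K])
      show "(a \<phi>0, b \<phi>0) \<in> K"
        unfolding K_def using \<phi>0 by (intro subsetD[OF closure_subset] imageI)
    next
      fix A B C M :: complex and N :: nat
      \<comment> \<open>With the third coordinate equal to \<open>b' n \<phi>\<close>, this is the
        value at \<open>\<Phi> \<phi>\<close> of an element of A built from \<open>F\<close> and
        \<open>bA n\<close>, so \<open>range_exp\<close> applies before the limit is taken.\<close>
      define g where "g y = M * ((A + B * fst y + C * snd (snd y)) ^ N - 1)" for y :: "complex \<times> complex \<times> complex"
      define k1 where "k1 y = fst y * exp (g y)" for y :: "complex \<times> complex \<times> complex"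
      define k2 where "k2 y = fst (snd y) * exp (g y)" for y :: "complex \<times> complex \<times> complex"
      have cont: "continuous_on UNIV k1" "continuous_on UNIV k2"
        unfolding k1_def k2_def g_def by (intro continuous_intros)+
      have ranges: "(\<lambda>\<phi>. k2 (a \<phi>, b \<phi>, b' n \<phi>)) ` characters = (\<lambda>\<phi>. k1 (a \<phi>, b \<phi>, b' n \<phi>)) ` characters" for n
      proof -
        define f where "f = cc M * ((cc A + cc B * F + cc C * bA n) ^ N - 1)"
        have "g (a \<phi>, b \<phi>, b' n \<phi>) = \<Phi> \<phi> f" if "\<phi> \<in> characters" for \<phi>
          by (simp add: g_def f_def a_def b'_def char_simps[OF \<Phi>(1)[OF that]])
        then show ?thesis
          using range_exp[of F f] by (simp add: k1_def k2_def a_def b_def)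
      qed
      have "(\<lambda>y. k1 (fst y, snd y, snd y)) ` K \<subseteq> (\<lambda>y. k2 (fst y, snd y, snd y)) ` K"
        unfolding K_def
      proof (rule exp_ranges_closure[where b' = b' and ?k1.0 = k1 and ?k2.0 = k2, OF K[unfolded K_def] cont lim])
        fix n and i :: "'b \<Rightarrow> complex"
        assume "i \<in> characters"
        then have "k1 (a i, b i, b' n i) \<in> (\<lambda>\<phi>. k2 (a \<phi>, b \<phi>, b' n \<phi>)) ` characters"
          unfolding ranges by (rule imageI)
        then show "\<exists>j\<in>characters. k1 (a i, b i, b' n i) = k2 (a j, b j, b' n j)"
          by blast
      qed
      moreover have "(\<lambda>y. k2 (fst y, snd y, snd y)) ` K \<subseteq> (\<lambda>y. k1 (fst y, snd y, snd y)) ` K"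
        unfolding K_def
      proof (rule exp_ranges_closure[where b' = b' and ?k1.0 = k2 and ?k2.0 = k1, OF K[unfolded K_def] cont(2,1) lim])
        fix n and i :: "'b \<Rightarrow> complex"
        assume "i \<in> characters"
        then have "k2 (a i, b i, b' n i) \<in> (\<lambda>\<phi>. k1 (a \<phi>, b \<phi>, b' n \<phi>)) ` characters"
          unfolding ranges[symmetric] by (rule imageI)
        then show "\<exists>j\<in>characters. k2 (a i, b i, b' n i) = k1 (a j, b j, b' n j)"
          by blast
      qed
      ultimately have "(\<lambda>y. k1 (fst y, snd y, snd y)) ` K = (\<lambda>y. k2 (fst y, snd y, snd y)) ` K"
        by (rule equalityI)
      then show "(\<lambda>y. fst y * exp (M * ((A + B * fst y + C * snd y) ^ N - 1))) ` K
        = (\<lambda>y. snd y * exp (M * ((A + B * fst y + C * snd y) ^ N - 1))) ` K"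
        unfolding k1_def k2_def g_def fst_conv snd_conv .
    qed
    then show ?thesis
      by (simp add: a_def b_def)
  qed
  have "algebra_isomorphism U"
    unfolding algebra_isomorphism_def
  proof (intro conjI allI)
    show "bij U"
    proof (rule bijI)
      show "inj U"
      proof (rule injI)
        fix f g assume "U f = U g"
        then have eq: "\<Phi> \<phi> f = \<Phi> \<phi> g" if "\<phi> \<in> characters" for \<phi>
          using U_char[OF that, of f] U_char[OF that, of g] by simp
        show "f = g"
        proof (rule sepA)
          fix \<theta> :: "'a \<Rightarrow> complex"
          assume "\<theta> \<in> characters"
          then obtain \<phi> where "\<phi> \<in> characters" "\<Phi> \<phi> = \<theta>"
            using \<Phi>_onto by blast
          then show "\<theta> f = \<theta> g"
            using eq by blast
        qed
      qed
      show "surj U"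
        unfolding surj_def using surjU by (blast intro: sym)
    qed
    fix f g and z :: complex
    show "U (f + g) = U f + U g"
      by (rule sepB) (simp only: char_add U_char \<Phi>(1))
    show "U (z *\<^sub>C f) = z *\<^sub>C U f"
      by (rule sepB) (simp only: char_scaleC U_char \<Phi>(1))
    show "U (f * g) = U f * U g"
      by (rule sepB) (simp only: char_mult U_char \<Phi>(1))
  qed
  moreover have "S1 F = S1 1 * U F" for F
    using kU[of F] unfolding k_def by (rule sym)
  ultimately show ?thesis
    using that[OF ssB _ _ S12] by blast
qed

section \<open>Quadratic polynomials\<close>

lemma algebra_isomorphism_inv:
  assumes "algebra_isomorphism U"
  shows "algebra_isomorphism (inv U)"
proof -
  have b: "bij U"
    using assms by (simp add: algebra_isomorphism_def)
  have [simp]: "U (inv U y) = y" for y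
    using b by (simp add: bij_is_surj surj_f_inv_f)
  have inv_eq: "inv U y = x" if "U x = y" for x y
    using b that by (metis bij_inv_eq_iff)
  show ?thesis
    using assms b unfolding algebra_isomorphism_def
    by (auto intro!: inv_eq bij_imp_bij_inv)
qed

lemma algebra_isomorphism_1:
  assumes "algebra_isomorphism U"
  shows "U 1 = 1"
proof -
  have "bij U" and mult: "\<And>f g. U (f * g) = U f * U g"
    using assms by (simp_all add: algebra_isomorphism_def)
  then obtain x where "U x = 1"
    by (metis bij_pointE)
  then show ?thesis
    using mult[of 1 x] by simp
qed

lemma character_comp_isomorphism:
  assumes "algebra_isomorphism U" "\<phi> \<in> characters"
  shows "\<phi> \<circ> U \<in> characters"
proof -
  have "\<phi> (U 1) \<noteq> 0"
    using algebra_isomorphism_1[OF assms(1)] char_1[OF assms(2)] by simp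
  then show ?thesis
    using assms(1) char_add[OF assms(2)] char_mult[OF assms(2)] char_scaleC[OF assms(2)]
    unfolding maximal_ideal_space_def algebra_isomorphism_def by auto
qed

lemma topspace_gelfand [simp]: "topspace gelfand_topology = maximal_ideal_space"
  by (simp add: gelfand_topology_def)

lemma continuous_map_comp_isomorphism:
  assumes "algebra_isomorphism U"
  shows "continuous_map gelfand_topology gelfand_topology (\<lambda>\<phi>. \<phi> \<circ> U)"
proof -
  have "continuous_map gelfand_topology euclidean (\<lambda>\<phi>. \<phi> (U k))" for k
    unfolding gelfand_topology_def
    by (intro continuous_map_from_subtopology continuous_map_product_projection) simp
  then have "continuous_map gelfand_topology (product_topology (\<lambda>_. euclidean) UNIV) (\<lambda>\<phi>. \<phi> \<circ> U)"
    by (simp add: continuous_map_componentwise_UNIV)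
  then show ?thesis
    unfolding gelfand_topology_def[where 'a='a] continuous_map_in_subtopology
    using character_comp_isomorphism[OF assms] by auto
qed

lemma homeomorphic_map_comp_isomorphism:
  assumes "algebra_isomorphism U"
  shows "homeomorphic_map gelfand_topology gelfand_topology (\<lambda>\<phi>. \<phi> \<circ> U)"
proof -
  have "bij U"
    using assms by (simp add: algebra_isomorphism_def)
  then have "U \<circ> inv U = id" "inv U \<circ> U = id"
    using bij_is_surj[of U] bij_is_inj[of U] surj_iff[of U] by simp_all
  then have "homeomorphic_maps gelfand_topology gelfand_topology (\<lambda>\<phi>. \<phi> \<circ> U) (\<lambda>\<phi>. \<phi> \<circ> inv U)"
    unfolding homeomorphic_maps_def
    using continuous_map_comp_isomorphism[OF assms]
      continuous_map_comp_isomorphism[OF algebra_isomorphism_inv[OF assms]]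
    by (simp add: comp_assoc)
  then show ?thesis
    by (rule homeomorphic_maps_imp_map)
qed

lemma spectrum_add_cc: "spectrum (x + cc z) = (\<lambda>w. w + z) ` spectrum x"
  unfolding spectrum_eq image_image by (intro image_cong refl) (simp add: char_simps)

lemma spectrum_add_cc_cancel: "spectrum (x + cc z) = spectrum (y + cc z) \<longleftrightarrow> spectrum x = spectrum y"
  unfolding spectrum_add_cc by (rule inj_image_eq_iff) (simp add: inj_def)

lemma quad_poly_factor:
  "quad_poly a b c f g = (f + cc b) * (g + cc a) + cc (c - a * b)"
  by (simp add: quad_poly_def scaleC_eq_cc cc_diff cc_mult algebra_simps)

theorem theorem5p2:
  fixes T :: "'a::complex_comm_banach_algebra_1 \<Rightarrow> 'b::complex_comm_banach_algebra_1"
    and a b c :: complex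
  assumes "semisimple TYPE('a)"
    and "surj T"
    and "\<And>f g. spectrum (quad_poly a b c (T f) (T g)) = spectrum (quad_poly a b c f g)"
  shows "(a \<noteq> b \<longrightarrow>
            algebra_isomorphism T \<and>
            (\<exists>\<Phi> :: ('b \<Rightarrow> complex) \<Rightarrow> ('a \<Rightarrow> complex).
               homeomorphic_map gelfand_topology gelfand_topology \<Phi> \<and>
               (\<forall>f. \<forall>y\<in>maximal_ideal_space.
                  gelfand_transform (T f) y = gelfand_transform f (\<Phi> y)))) \<and>
         (a = b \<longrightarrow>
            (\<exists>(\<eta> :: ('b \<Rightarrow> complex) \<Rightarrow> complex) (\<Phi> :: ('b \<Rightarrow> complex) \<Rightarrow> ('a \<Rightarrow> complex)).
               \<eta> ` maximal_ideal_space \<subseteq> {-1, 1} \<and>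
               homeomorphic_map gelfand_topology gelfand_topology \<Phi> \<and>
               (\<forall>f. \<forall>y\<in>maximal_ideal_space.
                  gelfand_transform (T f) y =
                    \<eta> y * gelfand_transform f (\<Phi> y) + a * (\<eta> y - 1)))) \<and>
         semisimple TYPE('b) \<and>
         (\<exists>S :: 'a \<Rightarrow> 'b. algebra_isomorphism S)"
proof -
  define S1 where "S1 F = T (F - cc b) + cc b" for F
  define S2 where "S2 G = T (G - cc a) + cc a" for G
  have surj_S: "surj (\<lambda>F. T (F - cc z) + cc z)" for z
  proof (rule surjI)
    fix y
    show "T (inv T (y - cc z) + cc z - cc z) + cc z = y"
      using assms(2) by (simp add: surj_f_inv_f)
  qed
  have "surj S1" "surj S2"
    using surj_S[of b] surj_S[of a] by (simp_all add: S1_def[abs_def] S2_def[abs_def])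
  moreover have "spectrum (S1 F * S2 G) = spectrum (F * G)" for F G
    using assms(3)[of "F - cc b" "G - cc a"]
    by (simp add: quad_poly_factor spectrum_add_cc_cancel S1_def S2_def)
  ultimately obtain U where ssB: "semisimple TYPE('b)" and U: "algebra_isomorphism U"
    and S1U: "\<And>F. S1 F = S1 1 * U F" and S12: "\<And>x. x dvd 1 \<Longrightarrow> S1 x * S2 (uinv x) = 1"
    using product_spectrum_preserver[OF assms(1), of S1 S2] by metis
  have U_add: "U (f + g) = U f + U g" and U_scaleC: "U (z *\<^sub>C f) = z *\<^sub>C U f" for f g z
    using U by (simp_all add: algebra_isomorphism_def)
  have U_cc: "U (cc z) = cc z" for z
    by (simp add: cc_def U_scaleC algebra_isomorphism_1[OF U])
  have sepB: "y = y'" if "\<And>\<phi>. \<phi> \<in> characters \<Longrightarrow> \<phi> y = \<phi> y'" for y y' :: 'b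
    using ssB that by (auto simp: semisimple_iff_separating)
  define k where "k = S1 1"
  have T_U: "T f = k * U f + cc b * (k - 1)" for f
  proof -
    have "T f = S1 (f + cc b) - cc b"
      by (simp add: S1_def)
    also have "\<dots> = k * (U f + cc b) - cc b"
      using S1U[of "f + cc b"] by (simp add: k_def U_add U_cc)
    finally show ?thesis
      by (simp add: algebra_simps)
  qed
  have uinv_one: "uinv 1 = (1::'a)" "uinv (- 1) = (- 1 :: 'a)"
    using mult_uinv[of "1::'a"] mult_uinv[of "- 1::'a"] by (simp_all add: minus_equation_iff)
  \<comment> \<open>The units 1 and -1 are their own inverses. At them the relation between
    \<open>S1\<close> and \<open>S2\<close> reads k (k + d) = 1 and k (k - d) = 1 with k evaluated
    at \<phi>, so k d = 0 and \<open>d\<close> vanishes.\<close>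
  have "a \<noteq> b \<longrightarrow> k = 1"
  proof (intro impI sepB)
    fix \<phi> :: "'b \<Rightarrow> complex" assume ab: "a \<noteq> b" and \<phi>: "\<phi> \<in> characters"
    define d where "d = (b - a) * (\<phi> k - 1)"
    have U_m1: "U (- 1) = - 1"
      using U_cc[of "- 1"] by (simp add: cc_minus)
    have S2_U: "S2 G = k * U G + cc (b - a) * (k - 1)" for G
    proof -
      have "U (G - cc a) = U G - cc a"
        using U_add[of "G - cc a" "cc a"] by (simp add: U_cc)
      then have "S2 G = k * (U G - cc a) + cc b * (k - 1) + cc a"
        by (simp only: S2_def T_U)
      then show ?thesis
        by (simp add: cc_diff algebra_simps)
    qed
    have S2: "\<phi> (S2 1) = \<phi> k + d" "\<phi> (S2 (- 1)) = - \<phi> k + d"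
      by (simp_all add: S2_U U_m1 algebra_isomorphism_1[OF U] char_simps[OF \<phi>] d_def)
    have "\<phi> (S1 1 * S2 1) = 1" "\<phi> (S1 (- 1) * S2 (- 1)) = 1"
      using S12[of 1] S12[of "- 1"] char_1[OF \<phi>] by (simp_all add: uinv_one)
    then have e: "\<phi> k * (\<phi> k + d) = 1" "- \<phi> k * (- \<phi> k + d) = 1"
      using S1U[of "- 1"] S2 by (simp_all add: char_simps[OF \<phi>] U_m1 k_def[symmetric])
    then have "\<phi> k * d = 0"
      by algebra
    moreover have "\<phi> k \<noteq> 0"
      using e(1) by auto
    ultimately show "\<phi> k = \<phi> 1"
      using ab by (simp add: d_def char_1[OF \<phi>])
  qed
  then have T_eq: "a \<noteq> b \<longrightarrow> T = U"
    by (auto simp: T_U)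
  \<comment> \<open>For \<open>a = b\<close> the maps \<open>S1\<close> and \<open>S2\<close>
    coincide, and the relation at the unit 1 becomes \<open>k * k = 1\<close>. The sign function is
    the Gelfand transform of \<open>k\<close>.\<close>
  have \<eta>: "a = b \<longrightarrow> (\<lambda>\<phi>. \<phi> k) ` characters \<subseteq> {-1, 1}"
  proof (intro impI subsetI)
    fix z assume "a = b" and "z \<in> (\<lambda>\<phi>. \<phi> k) ` characters"
    then obtain \<phi> where \<phi>: "\<phi> \<in> characters" "z = \<phi> k"
      by blast
    have "k * k = 1"
      using S12[of 1] \<open>a = b\<close> by (simp add: uinv_one k_def S1_def S2_def)
    then have "z * z = 1"
      using char_mult[OF \<phi>(1)] char_1[OF \<phi>(1)] \<phi>(2) by metis
    then show "z \<in> {-1, 1}"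
      using square_eq_1_iff by blast
  qed
  have hom: "homeomorphic_map gelfand_topology gelfand_topology (\<lambda>\<phi>. \<phi> \<circ> U)"
    by (rule homeomorphic_map_comp_isomorphism[OF U])
  have \<Phi>: "\<forall>f. \<forall>\<phi>\<in>characters. gelfand_transform (U f) \<phi> = gelfand_transform f (\<phi> \<circ> U)"
    by (simp add: gelfand_transform_def)
  have T_char: "\<forall>f. \<forall>\<phi>\<in>characters. gelfand_transform (T f) \<phi> = \<phi> k * gelfand_transform f (\<phi> \<circ> U) + b * (\<phi> k - 1)"
    by (simp add: gelfand_transform_def T_U char_simps)
  show ?thesis
  proof (intro conjI impI)
    assume "a \<noteq> b"
    then have "T = U"
      using T_eq by blast
    then show "algebra_isomorphism T"
      using U by simp
    show "\<exists>\<Phi>. homeomorphic_map gelfand_topology gelfand_topology \<Phi> \<and>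
        (\<forall>f. \<forall>y\<in>maximal_ideal_space. gelfand_transform (T f) y = gelfand_transform f (\<Phi> y))"
      using hom \<Phi> \<open>T = U\<close> by blast
  next
    assume "a = b"
    then show "\<exists>\<eta> \<Phi>. \<eta> ` maximal_ideal_space \<subseteq> {-1, 1} \<and>
        homeomorphic_map gelfand_topology gelfand_topology \<Phi> \<and>
        (\<forall>f. \<forall>y\<in>maximal_ideal_space.
           gelfand_transform (T f) y = \<eta> y * gelfand_transform f (\<Phi> y) + a * (\<eta> y - 1))"
      using \<eta> hom T_char by blast
  next
    show "semisimple TYPE('b)" "\<exists>S :: 'a \<Rightarrow> 'b. algebra_isomorphism S"
      using ssB U by blast+
  qed
qed

end
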